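(* Let $(X,d,\mathcal{S})$ be a recursively compact computable metric space and let $(K,f)$ be a computable dynamical system in $X$. Then the topological entropy $h(K,f)$ is a $\Sigma_2$-computable number.
   Context: "Algorithm" means Turing machine; countable sets such as $\mathbb{Q}$ are identified with integers via a fixed effective numbering. A computable metric space is a triple $(X,d,\mathcal{S})$ where $(X,d)$ is a metric space and $\mathcal{S}=\{s_i: i\ge 0\}$ is a countable dense subset (its elements are called ideal points) such that some algorithm, on input $(i,j,n)\in\mathbb{N}^3$, outputs $r\in\mathbb{Q}$ with $|d(s_i,s_j)-r|\le 2^{-n}$. Ideal balls are the open balls centered at ideal points with positive rational radii; fix a computable enumeration $(B_n)_{n\in\mathbb{N}}$ of them (center index and radius computable from $n$). For $I\subset\mathbb{N}$, $U_I=\bigcup_{n\in I}B_n$. The space is recursively compact if $(X,d)$ is compact and there is an algorithm which, given a finite $I\subset\mathbb{N}$, halts if and only if $X\subset U_I$. A closed set $K\subset X$ is effective if there is an algorithm such that $X\setminus K=U_I$, where $I$ is the set of integers on which the algorithm halts. A function $f:X\to X$ is computable if there is an algorithm which, given $m$, enumerates a set $I_m\subset\mathbb{N}$ with $f^{-1}(B_m)=U_{I_m}$. A dynamical system in $X$ is a pair $(K,f)$ with $f:X\to X$ continuous and $K\subset X$ (non-empty) compact with $f(K)\subset K$. It is computable if $f$ is computable and $K$ is effective. An open cover of $K$ is a collection of open subsets of $X$ whose union contains $K$; a sub-cover is a subcollection which is still a cover of $K$. The join is $\mathcal{U}\vee\mathcal{U}'=\{U\cap U': U\in\mathcal{U},U'\in\mathcal{U}'\}$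 and $f^{-1}(\mathcal{U})=\{f^{-1}(U):U\in\mathcal{U}\}$. $N_n(K,f,\mathcal{U})$ is the minimal cardinality of a sub-cover (of $K$) of $\bigvee_{0\le k\le n-1}f^{-k}(\mathcal{U})$, $h(K,f,\mathcal{U})=\inf_{n\ge1}\frac{\log_2 N_n(K,f,\mathcal{U})}{n}$, and $h(K,f)=\sup\{h(K,f,\mathcal{U}):\mathcal{U}\text{ finite open cover of }K\}$. A number $x$ is $\Sigma_2$-computable if there is an algorithm computing a double sequence $(q_{ij})$ of rationals with $x=\sup_i\inf_j q_{ij}$; the value $x=+\infty$ is allowed. *)

theory Defs
  imports "HOL-Analysis.Analysis" "HOL-Library.Nat_Bijection" "HOL-Library.Countable"
begin

section \<open>Turing machines\<close>

text \<open>
  Deterministic multi-tape machines over two-way infinite tapes. States and symbols are natural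
  numbers; finiteness of the transition table makes the state set and the alphabet finite.
  The start state is \<open>0\<close> and the blank is \<open>0\<close>. The table maps a state and the list of scanned
  symbols to a new state and, for each tape, a symbol to write and a head move. The machine
  halts when no transition applies.

  Tape \<open>0\<close> is the output tape, initially blank; the \<open>i\<close>-th argument is written in unary on
  tape \<open>i\<close>; all further tapes are blank work tapes.
\<close>

datatype move = Go_Left | Stay | Go_Right

fun shift :: "move \<Rightarrow> int" where
  "shift Go_Left = -1"
| "shift Stay = 0"
| "shift Go_Right = 1"

record tm =
  tapes :: nat
  delta :: "nat \<times> nat list \<Rightarrow> (nat \<times> (nat \<times> move) list) option"

definition turing_machine :: "tm \<Rightarrow> bool" where
  "turing_machine M \<longleftrightarrow>
     0 < tapes M \<and> finite (dom (delta M)) \<and>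
     (\<forall>q a q' w. delta M (q, a) = Some (q', w) \<longrightarrow> length a = tapes M \<and> length w = tapes M)"

record config =
  state :: nat
  cells :: "nat \<Rightarrow> int \<Rightarrow> nat"
  head :: "nat \<Rightarrow> int"

definition scanned :: "tm \<Rightarrow> config \<Rightarrow> nat list" where
  "scanned M c = map (\<lambda>i. cells c i (head c i)) [0..<tapes M]"

definition halted :: "tm \<Rightarrow> config \<Rightarrow> bool" where
  "halted M c \<longleftrightarrow> delta M (state c, scanned M c) = None"

definition step :: "tm \<Rightarrow> config \<Rightarrow> config" where
  "step M c =
     (case delta M (state c, scanned M c) of
        None \<Rightarrow> c
      | Some (q, w) \<Rightarrow>
          \<lparr> state = q,
            cells = (\<lambda>i. if i < tapes M then (cells c i)(head c i := fst (w ! i)) else cells c i),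
            head = (\<lambda>i. if i < tapes M then head c i + shift (snd (w ! i)) else head c i) \<rparr>)"

definition unary :: "nat \<Rightarrow> int \<Rightarrow> nat" where
  "unary n z = (if 0 \<le> z \<and> z < int n then 1 else 0)"

definition initial :: "nat list \<Rightarrow> config" where
  "initial xs =
     \<lparr> state = 0,
       cells = (\<lambda>i. if 1 \<le> i \<and> i \<le> length xs then unary (xs ! (i - 1)) else (\<lambda>z. 0)),
       head = (\<lambda>i. 0) \<rparr>"

definition run :: "tm \<Rightarrow> nat list \<Rightarrow> nat \<Rightarrow> config" where
  "run M xs t = (step M ^^ t) (initial xs)"

definition halts_on :: "tm \<Rightarrow> nat list \<Rightarrow> bool" where
  "halts_on M xs \<longleftrightarrow> (\<exists>t. halted M (run M xs t))"

definition outputs :: "tm \<Rightarrow> nat list \<Rightarrow> nat \<Rightarrow> bool" where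
  "outputs M xs y \<longleftrightarrow> (\<exists>t. halted M (run M xs t) \<and> cells (run M xs t) 0 = unary y)"

text \<open>
  Enumeration by a possibly non-halting computation: each time the machine is in the
  designated state \<open>p\<close>, the number then written on the output tape is put into the set.
\<close>

definition enumerated :: "tm \<Rightarrow> nat \<Rightarrow> nat list \<Rightarrow> nat set" where
  "enumerated M p xs = {y. \<exists>t. state (run M xs t) = p \<and> cells (run M xs t) 0 = unary y}"

section \<open>Computable metric spaces\<close>

text \<open>
  The space is the whole type. Rationals are coded by the library's numbering
  \<^const>\<open>nat_to_rat_surj\<close>, and finite sets of naturals by \<^const>\<open>set_decode\<close>.
\<close>

definition computable_metric_space :: "(nat \<Rightarrow> 'a::metric_space) \<Rightarrow> bool" where
  "computable_metric_space s \<longleftrightarrow>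
     closure (range s) = UNIV \<and>
     (\<exists>M. turing_machine M \<and>
        (\<forall>i j n. \<exists>c. outputs M [i, j, n] c \<and>
           \<bar>dist (s i) (s j) - real_of_rat (nat_to_rat_surj c)\<bar> \<le> 1 / 2 ^ n))"

text \<open>
  The index \<open>prod_encode (i, prod_encode (a, b))\<close> stands for the ball with centre \<open>s i\<close> and
  radius \<open>(a + 1) / (b + 1)\<close>, so that all positive rational radii, and only those, occur.
\<close>

definition ideal_ball :: "(nat \<Rightarrow> 'a::metric_space) \<Rightarrow> nat \<Rightarrow> 'a set" where
  "ideal_ball s n =
     (let (i, k) = prod_decode n; (a, b) = prod_decode k
      in ball (s i) (real (a + 1) / real (b + 1)))"

definition ball_union :: "(nat \<Rightarrow> 'a::metric_space) \<Rightarrow> nat set \<Rightarrow> 'a set" where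
  "ball_union s I = (\<Union>n\<in>I. ideal_ball s n)"

definition recursively_compact :: "(nat \<Rightarrow> 'a::metric_space) \<Rightarrow> bool" where
  "recursively_compact s \<longleftrightarrow>
     compact (UNIV :: 'a set) \<and>
     (\<exists>M. turing_machine M \<and>
        (\<forall>e. halts_on M [e] \<longleftrightarrow> UNIV \<subseteq> ball_union s (set_decode e)))"

definition effective_closed :: "(nat \<Rightarrow> 'a::metric_space) \<Rightarrow> 'a set \<Rightarrow> bool" where
  "effective_closed s K \<longleftrightarrow>
     closed K \<and> (\<exists>M. turing_machine M \<and> UNIV - K = ball_union s {n. halts_on M [n]})"

definition computable_map :: "(nat \<Rightarrow> 'a::metric_space) \<Rightarrow> ('a \<Rightarrow> 'a) \<Rightarrow> bool" where
  "computable_map s f \<longleftrightarrow>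
     (\<exists>M p. turing_machine M \<and>
        (\<forall>m. f -` ideal_ball s m = ball_union s (enumerated M p [m])))"

section \<open>Dynamical systems and topological entropy\<close>

definition dynamical_system :: "'a::topological_space set \<Rightarrow> ('a \<Rightarrow> 'a) \<Rightarrow> bool" where
  "dynamical_system K f \<longleftrightarrow> continuous_on UNIV f \<and> K \<noteq> {} \<and> compact K \<and> f ` K \<subseteq> K"

definition computable_dynamical_system ::
    "(nat \<Rightarrow> 'a::metric_space) \<Rightarrow> 'a set \<Rightarrow> ('a \<Rightarrow> 'a) \<Rightarrow> bool" where
  "computable_dynamical_system s K f \<longleftrightarrow>
     dynamical_system K f \<and> computable_map s f \<and> effective_closed s K"

definition open_cover :: "'a::topological_space set \<Rightarrow> 'a set set \<Rightarrow> bool" where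
  "open_cover K \<U> \<longleftrightarrow> (\<forall>U\<in>\<U>. open U) \<and> K \<subseteq> \<Union>\<U>"

definition join :: "'a set set \<Rightarrow> 'a set set \<Rightarrow> 'a set set" where
  "join \<U> \<V> = {U \<inter> V |U V. U \<in> \<U> \<and> V \<in> \<V>}"

definition preimage_cover :: "('a \<Rightarrow> 'a) \<Rightarrow> 'a set set \<Rightarrow> 'a set set" where
  "preimage_cover f \<U> = (\<lambda>U. f -` U) ` \<U>"

text \<open>
  The join of \<open>f\<^sup>-\<^sup>k(\<U>)\<close> over \<open>k < n\<close>; the empty join is the unit \<open>{UNIV}\<close> of
  \<^const>\<open>join\<close>.
\<close>

fun iterated_join :: "('a \<Rightarrow> 'a) \<Rightarrow> 'a set set \<Rightarrow> nat \<Rightarrow> 'a set set" where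
  "iterated_join f \<U> 0 = {UNIV}"
| "iterated_join f \<U> (Suc n) = join (iterated_join f \<U> n) ((preimage_cover f ^^ n) \<U>)"

text \<open>Only used for compact \<open>K\<close>, where a finite sub-cover exists and the minimum is attained.\<close>

definition cover_number :: "'a set \<Rightarrow> ('a \<Rightarrow> 'a) \<Rightarrow> 'a set set \<Rightarrow> nat \<Rightarrow> nat" where
  "cover_number K f \<U> n =
     (LEAST m. \<exists>\<V>. \<V> \<subseteq> iterated_join f \<U> n \<and> K \<subseteq> \<Union>\<V> \<and> finite \<V> \<and> card \<V> = m)"

definition cover_entropy :: "'a set \<Rightarrow> ('a \<Rightarrow> 'a) \<Rightarrow> 'a set set \<Rightarrow> ereal" where
  "cover_entropy K f \<U> = (INF n\<in>{1..}. ereal (log 2 (real (cover_number K f \<U> n)) / real n))"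

definition topological_entropy :: "'a::topological_space set \<Rightarrow> ('a \<Rightarrow> 'a) \<Rightarrow> ereal" where
  "topological_entropy K f = (SUP \<U>\<in>{\<U>. finite \<U> \<and> open_cover K \<U>}. cover_entropy K f \<U>)"

section \<open>Second-level computable numbers\<close>

definition Sigma2_computable :: "ereal \<Rightarrow> bool" where
  "Sigma2_computable x \<longleftrightarrow>
     x \<noteq> - \<infinity> \<and>
     (\<exists>M q. turing_machine M \<and>
        (\<forall>i j. \<exists>c. outputs M [i, j] c \<and> nat_to_rat_surj c = q i j) \<and>
        x = (SUP i. INF j. ereal (real_of_rat (q i j))))"

end

theory Submission imports Defs begin

text \<open>
  Fix a scale \<open>1 / (k + 1)\<close> and call an ideal ball small if its radius is below it. A word of
  \<open>n\<close> small balls \<open>B\<^sub>0, \<dots>, B\<^sub>n\<^sub>-\<^sub>1\<close> describes the set of points whose orbit visits these balls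
  in turn. Let \<open>H\<^sub>k\<close> be the infimum of \<open>a / n\<close> over all \<open>a\<close> and \<open>n \<ge> 1\<close> such that \<open>2\<^sup>a\<close> words of
  length \<open>n\<close> suffice to cover \<open>K\<close>. Then \<open>h(K, f) = sup\<^sub>k H\<^sub>k\<close>
  (\<open>topological_entropy_eq_SUP_scale_entropy\<close>): every finite open cover of \<open>K\<close> has a Lebesgue
  number, so its entropy is at most \<open>H\<^sub>k\<close> for large \<open>k\<close>; conversely \<open>K\<close> has a finite cover by
  small balls, and concatenating words shows that restricting the sizes of covers to powers of
  two does not change the exponential growth rate.

  This form of the entropy is already of the second level, provided that the existence of a
  cover of \<open>K\<close> by \<open>2\<^sup>a\<close> words of length \<open>n\<close> is a semidecidable condition on \<open>k\<close>, \<open>a\<close>, \<open>n\<close>. It is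
  (\<open>semidecidable_word_cover\<close>): by compactness a cover is witnessed by finitely many ideal balls
  that cover the whole space and each of which either misses \<open>K\<close> or is certified to lie in the
  set described by one of the words. Let \<open>q\<^sub>k\<^sub>j = a / n\<close> if \<open>j\<close> codes \<open>a\<close>, \<open>n\<close> and a witness for
  \<open>k\<close>, \<open>a\<close>, \<open>n\<close>, and \<open>q\<^sub>k\<^sub>j = k\<close> otherwise. The infimum over \<open>j\<close> lies between \<open>min k H\<^sub>k\<close> and
  \<open>H\<^sub>k\<close>, and since \<open>H\<^sub>k\<close> increases with \<open>k\<close>, the supremum over \<open>k\<close> is \<open>h(K, f)\<close>.

  The array \<open>q\<close> is computed by a Turing machine because it is primitive recursive. Two facts
  link the machines to primitive recursion. Every primitive recursive function is computed by a
  program with bounded loops on finitely many registers, which is translated into a machine with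
  one tape for each register (\<open>turing_computes_prim_rec\<close>). Conversely, the configuration that a
  given machine reaches after \<open>t\<close> steps is a primitive recursive function of the input and \<open>t\<close>
  (\<open>run_code\<close>), so that conditions on the runs of the machines given with the space, with \<open>K\<close>
  and with \<open>f\<close> may occur in a witness.
\<close>

section \<open>Register programs executed by Turing machines\<close>

text \<open>
  The loop over register \<open>r\<close> runs its body as often as the value of \<open>r\<close> on entry says, and
  leaves \<open>r\<close> at zero. All programs terminate, which makes their semantics a total function;
  bounded loops are all that primitive recursion needs.
\<close>

datatype prog = Skip | Inc nat | Dec nat | Seq prog prog | Loop nat prog

primrec regs :: "prog \<Rightarrow> nat set" where
  "regs Skip = {}"
| "regs (Inc r) = {r}"
| "regs (Dec r) = {r}"
| "regs (Seq p p') = regs p \<union> regs p'"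
| "regs (Loop r p) = insert r (regs p)"

text \<open>
  Register \<open>0\<close> is kept on the output tape, which can only grow: it may be incremented, but
  neither decremented nor tested.
\<close>

primrec wf_prog :: "prog \<Rightarrow> bool" where
  "wf_prog Skip \<longleftrightarrow> True"
| "wf_prog (Inc r) \<longleftrightarrow> True"
| "wf_prog (Dec r) \<longleftrightarrow> r \<noteq> 0"
| "wf_prog (Seq p p') \<longleftrightarrow> wf_prog p \<and> wf_prog p'"
| "wf_prog (Loop r p) \<longleftrightarrow> r \<noteq> 0 \<and> r \<notin> regs p \<and> wf_prog p"

primrec exec :: "prog \<Rightarrow> (nat \<Rightarrow> nat) \<Rightarrow> nat \<Rightarrow> nat" where
  "exec Skip \<sigma> = \<sigma>"
| "exec (Inc r) \<sigma> = \<sigma>(r := Suc (\<sigma> r))"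
| "exec (Dec r) \<sigma> = \<sigma>(r := \<sigma> r - 1)"
| "exec (Seq p p') \<sigma> = exec p' (exec p \<sigma>)"
| "exec (Loop r p) \<sigma> = (exec p ^^ \<sigma> r) (\<sigma>(r := 0))"

lemma regs_bounded: "\<exists>T. regs p \<subseteq> {..<T}"
proof -
  have "finite (regs p)" by (induction p) auto
  then show ?thesis by (simp add: finite_nat_iff_bounded)
qed

text \<open>
  A machine decrements the loop register once in each round, whereas \<open>exec\<close> clears it before the
  first round. The two agree because the body, which does not mention the register, acts in the
  same way whatever its value.
\<close>

lemma exec_frame:
  assumes "r \<notin> regs p"
  shows "exec p (\<sigma>(r := v)) = (exec p \<sigma>)(r := v)"
  using assms
proof (induction p arbitrary: \<sigma>)
  case (Loop r' p)
  have "(exec p ^^ n) (\<tau>(r := v)) = ((exec p ^^ n) \<tau>)(r := v)" for n \<tau>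
    by (induction n) (use Loop in auto)
  moreover have "\<sigma>(r := v, r' := 0) = \<sigma>(r' := 0, r := v)" "(\<sigma>(r := v)) r' = \<sigma> r'"
    using Loop.prems by (auto simp: fun_upd_twist)
  ultimately show ?case by (simp del: fun_upd_apply)
qed (auto simp: fun_upd_twist)

primrec num_states :: "prog \<Rightarrow> nat" where
  "num_states Skip = 0"
| "num_states (Inc r) = 2"
| "num_states (Dec r) = 1"
| "num_states (Seq p p') = num_states p + num_states p'"
| "num_states (Loop r p) = num_states p + 2"

definition keep :: "nat list \<Rightarrow> (nat \<times> move) list" where
  "keep a = map (\<lambda>x. (x, Stay)) a"

text \<open>
  The transitions of a program placed at the states \<open>b, \<dots>, b + num_states p - 1\<close>; control
  leaves it at state \<open>b + num_states p\<close>. A positive register is a block of ones that starts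
  under the head and extends to the right. So a register is zero iff the scanned symbol is
  blank, decrementing erases a cell and moves right, and incrementing moves left and then writes
  a one. The input convention puts the arguments on their tapes in just this form. The output
  tape has its head after the last one, as it must keep its ones at the cells from \<open>0\<close> on.
\<close>

primrec transition :: "prog \<Rightarrow> nat \<Rightarrow> nat \<Rightarrow> nat list \<Rightarrow> nat \<times> (nat \<times> move) list" where
  "transition Skip b q a = (b, keep a)"
| "transition (Inc r) b q a =
     (if r = 0 then (b + 2, (keep a)[0 := (1, Go_Right)])
      else if q = b then (b + 1, (keep a)[r := (a ! r, Go_Left)])
      else (b + 2, (keep a)[r := (1, Stay)]))"
| "transition (Dec r) b q a =
     (b + 1, if a ! r = 1 then (keep a)[r := (0, Go_Right)] else keep a)"
| "transition (Seq p p') b q a =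
     (if q < b + num_states p then transition p b q a else transition p' (b + num_states p) q a)"
| "transition (Loop r p) b q a =
     (if q = b then if a ! r = 1 then (b + 1, (keep a)[r := (0, Go_Right)])
                    else (b + num_states p + 2, keep a)
      else if q = b + 1 + num_states p then (b, keep a)
      else transition p (b + 1) q a)"

lemma length_transition: "length (snd (transition p b q a)) = length a"
  by (induction p arbitrary: b) (auto simp: keep_def)

definition machine :: "nat \<Rightarrow> prog \<Rightarrow> tm" where
  "machine T p =
     \<lparr> tapes = T,
       delta = (\<lambda>(q, a). if q < num_states p \<and> length a = T \<and> set a \<subseteq> {0, 1}
                          then Some (transition p 0 q a) else None) \<rparr>"

lemma turing_machine_machine:
  assumes "0 < T"
  shows "turing_machine (machine T p)"
proof -
  have "dom (delta (machine T p)) \<subseteq> {..<num_states p} \<times> {a. set a \<subseteq> {0, 1} \<and> length a = T}"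
    by (auto simp: machine_def split: if_splits)
  moreover have "finite ({..<num_states p} \<times> {a. set a \<subseteq> {0, 1::nat} \<and> length a = T})"
    by (intro finite_cartesian_product finite_lists_length_eq) auto
  ultimately have "finite (dom (delta (machine T p)))"
    by (rule finite_subset)
  then show ?thesis
    using assms length_transition
    by (auto simp: turing_machine_def machine_def split: if_splits) (metis snd_conv)
qed

definition tape_holds :: "nat \<Rightarrow> nat \<Rightarrow> (int \<Rightarrow> nat) \<Rightarrow> int \<Rightarrow> bool" where
  "tape_holds i n t h \<longleftrightarrow>
     (if i = 0 then t = unary n \<and> h = int n else t = (\<lambda>z. unary n (z - h)))"

definition holds :: "nat \<Rightarrow> (nat \<Rightarrow> nat) \<Rightarrow> config \<Rightarrow> bool" where
  "holds T \<sigma> c \<longleftrightarrow> (\<forall>i<T. tape_holds i (\<sigma> i) (cells c i) (head c i))"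

lemma tape_holds_scan:
  "tape_holds i n t h \<Longrightarrow> t h = (if i \<noteq> 0 \<and> 0 < n then 1 else 0)"
  by (auto simp: tape_holds_def unary_def split: if_splits)

lemma tape_holds_out:
  "tape_holds 0 n t h \<Longrightarrow> tape_holds 0 (Suc n) (t(h := 1)) (h + 1)"
  by (auto simp: tape_holds_def unary_def fun_eq_iff)

lemma tape_holds_inc:
  "i \<noteq> 0 \<Longrightarrow> tape_holds i n t h \<Longrightarrow> tape_holds i (Suc n) (t(h - 1 := 1)) (h - 1)"
  by (auto simp: tape_holds_def unary_def fun_eq_iff)

lemma tape_holds_dec:
  "i \<noteq> 0 \<Longrightarrow> 0 < n \<Longrightarrow> tape_holds i n t h \<Longrightarrow> tape_holds i (n - 1) (t(h := 0)) (h + 1)"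
  by (auto simp: tape_holds_def unary_def fun_eq_iff)

lemma scanned_holds:
  assumes "holds (tapes M) \<sigma> c"
  shows "scanned M c = map (\<lambda>i. if i \<noteq> 0 \<and> 0 < \<sigma> i then 1 else 0) [0..<tapes M]"
  using assms by (auto simp: scanned_def holds_def tape_holds_scan)

definition follows :: "tm \<Rightarrow> prog \<Rightarrow> nat \<Rightarrow> bool" where
  "follows M p b \<longleftrightarrow>
     (\<forall>q a. b \<le> q \<and> q < b + num_states p \<and> length a = tapes M \<and> set a \<subseteq> {0, 1} \<longrightarrow>
        delta M (q, a) = Some (transition p b q a))"

lemma step_follows:
  assumes "follows M p b" and "set (scanned M c) \<subseteq> {0, 1}"
    and "b \<le> state c" "state c < b + num_states p"
  shows "step M c =
    (case transition p b (state c) (scanned M c) of (q, w) \<Rightarrow>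
       \<lparr> state = q,
         cells = (\<lambda>i. if i < tapes M then (cells c i)(head c i := fst (w ! i)) else cells c i),
         head = (\<lambda>i. if i < tapes M then head c i + shift (snd (w ! i)) else head c i) \<rparr>)"
proof -
  have "delta M (state c, scanned M c) = Some (transition p b (state c) (scanned M c))"
    using assms by (simp add: follows_def scanned_def)
  then show ?thesis by (simp add: step_def)
qed

lemma nth_keep [simp]: "i < length a \<Longrightarrow> keep a ! i = (a ! i, Stay)"
  and length_keep [simp]: "length (keep a) = length a"
  by (auto simp: keep_def)

lemma nth_scanned [simp]: "i < tapes M \<Longrightarrow> scanned M c ! i = cells c i (head c i)"
  and length_scanned [simp]: "length (scanned M c) = tapes M"
  by (auto simp: scanned_def)

text \<open>
  By induction on the program; the loop case is an inner induction on the number of remaining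
  rounds. The number of steps is immaterial, only the arrival at the exit state matters.
\<close>

lemma machine_executes:
  assumes "wf_prog p" "regs p \<subseteq> {..<tapes M}" "follows M p b"
    "holds (tapes M) \<sigma> c" "state c = b"
  shows "\<exists>t. state ((step M ^^ t) c) = b + num_states p \<and> holds (tapes M) (exec p \<sigma>) ((step M ^^ t) c)"
  using assms
proof (induction p arbitrary: b \<sigma> c)
  case Skip
  then show ?case by (intro exI[of _ 0]) auto
next
  case (Inc r)
  have sc: "set (scanned M c') \<subseteq> {0, 1}" if "holds (tapes M) \<tau> c'" for \<tau> c'
    using scanned_holds[OF that] by auto
  note st = step_follows[OF Inc.prems(3)]
  show ?case
  proof (cases "r = 0")
    case True
    have "step M c = \<lparr> state = b + 2, cells = (cells c)(0 := (cells c 0)(head c 0 := 1)),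
        head = (head c)(0 := head c 0 + 1)\<rparr>"
      using Inc.prems True st[OF sc] by (auto simp: fun_eq_iff nth_list_update)
    then show ?thesis
      using Inc.prems(4,5) True tape_holds_out
      by (intro exI[of _ 1]) (auto simp: holds_def)
  next
    case False
    have 1: "step M c = \<lparr> state = b + 1, cells = cells c, head = (head c)(r := head c r - 1)\<rparr>"
      using Inc.prems False st[OF sc] by (auto simp: fun_eq_iff nth_list_update)
    have sc1: "set (scanned M (step M c)) \<subseteq> {0, 1}"
    proof -
      have "cells c i z \<in> {0, 1}" if "i < tapes M" for i z
        using Inc.prems(4) that
        by (auto simp: holds_def tape_holds_def unary_def split: if_splits)
      then have "\<forall>x\<in>set (scanned M (step M c)). x \<in> {0, 1}"
        unfolding scanned_def 1 by simp
      then show ?thesis by blast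
    qed
    have "step M (step M c) = \<lparr> state = b + 2, cells = (cells c)(r := (cells c r)(head c r - 1 := 1)),
         head = (head c)(r := head c r - 1)\<rparr>"
      using Inc.prems False st[OF sc1] by (auto simp: fun_eq_iff nth_list_update 1)
    then show ?thesis
      using Inc.prems(4,5) False tape_holds_inc
      by (intro exI[of _ 2]) (auto simp: holds_def numeral_2_eq_2)
  qed
next
  case (Dec r)
  have sc: "set (scanned M c) \<subseteq> {0, 1}"
    using scanned_holds[OF Dec.prems(4)] by auto
  have r: "r \<noteq> 0" "r < tapes M" using Dec.prems by auto
  have h: "tape_holds r (\<sigma> r) (cells c r) (head c r)"
    using Dec.prems(4) r by (auto simp: holds_def)
  note st = step_follows[OF Dec.prems(3) sc]
  show ?case
  proof (cases "\<sigma> r = 0")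
    case True
    have "step M c = \<lparr> state = b + 1, cells = cells c, head = head c\<rparr>"
      using Dec.prems(5) r tape_holds_scan[OF h] True st
      by (auto simp: fun_eq_iff nth_list_update)
    then show ?thesis
      using Dec.prems(4,5) True
      by (intro exI[of _ 1]) (auto simp: holds_def)
  next
    case False
    have "step M c = \<lparr> state = b + 1, cells = (cells c)(r := (cells c r)(head c r := 0)),
        head = (head c)(r := head c r + 1)\<rparr>"
      using Dec.prems(5) r tape_holds_scan[OF h] False st
      by (auto simp: fun_eq_iff nth_list_update)
    then show ?thesis
      using Dec.prems(4,5) r False tape_holds_dec[of r "\<sigma> r"]
      by (intro exI[of _ 1]) (auto simp: holds_def)
  qed
next
  case (Seq p p')
  have "follows M p b" "follows M p' (b + num_states p)"
    using Seq.prems(3) by (auto simp: follows_def)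
  with Seq.prems obtain t where
    t: "state ((step M ^^ t) c) = b + num_states p" "holds (tapes M) (exec p \<sigma>) ((step M ^^ t) c)"
    using Seq.IH(1)[of b \<sigma> c] by auto
  with Seq.prems \<open>follows M p' (b + num_states p)\<close> obtain t' where
    "state ((step M ^^ t') ((step M ^^ t) c)) = b + num_states p + num_states p'"
    "holds (tapes M) (exec p' (exec p \<sigma>)) ((step M ^^ t') ((step M ^^ t) c))"
    using Seq.IH(2)[of "b + num_states p" "exec p \<sigma>" "(step M ^^ t) c"] by auto
  then show ?case
    by (intro exI[of _ "t' + t"]) (simp add: funpow_add add.assoc)
next
  case (Loop r p)
  have r: "r \<noteq> 0" "r < tapes M" "r \<notin> regs p" using Loop.prems by auto
  have body: "follows M p (b + 1)"
    using Loop.prems(3) by (auto simp: follows_def)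
  note st = step_follows[OF Loop.prems(3)]
  have "holds (tapes M) \<tau> d \<Longrightarrow> state d = b \<Longrightarrow> \<tau> r = n \<Longrightarrow>
      \<exists>t. state ((step M ^^ t) d) = b + num_states p + 2 \<and>
        holds (tapes M) ((exec p ^^ n) (\<tau>(r := 0))) ((step M ^^ t) d)" for n \<tau> d
  proof (induction n arbitrary: \<tau> d)
    case 0
    have sc: "set (scanned M d) \<subseteq> {0, 1}"
      using scanned_holds[OF 0(1)] by auto
    have h: "tape_holds r (\<tau> r) (cells d r) (head d r)"
      using 0 r by (auto simp: holds_def)
    have "step M d = \<lparr> state = b + num_states p + 2, cells = cells d, head = head d\<rparr>"
      using 0 r tape_holds_scan[OF h] st[OF sc] by (auto simp: fun_eq_iff)
    then show ?case using 0
      by (intro exI[of _ 1]) (auto simp: holds_def)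
  next
    case (Suc n)
    have sc: "set (scanned M d) \<subseteq> {0, 1}"
      using scanned_holds[OF Suc.prems(1)] by auto
    have h: "tape_holds r (\<tau> r) (cells d r) (head d r)"
      using Suc.prems r by (auto simp: holds_def)
    have 1: "step M d = \<lparr> state = b + 1, cells = (cells d)(r := (cells d r)(head d r := 0)),
        head = (head d)(r := head d r + 1)\<rparr>"
      using Suc.prems r tape_holds_scan[OF h] st[OF sc]
      by (auto simp: fun_eq_iff nth_list_update)
    have "holds (tapes M) (\<tau>(r := n)) (step M d)"
      using Suc.prems r tape_holds_dec[of r "\<tau> r"]
      by (auto simp: 1 holds_def)
    with Loop.IH[of "b + 1" "\<tau>(r := n)" "step M d"] body Loop.prems 1 obtain t where
      t: "state ((step M ^^ t) (step M d)) = b + 1 + num_states p"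
      "holds (tapes M) (exec p (\<tau>(r := n))) ((step M ^^ t) (step M d))"
      by (auto simp del: fun_upd_apply)
    let ?d = "(step M ^^ t) (step M d)"
    have sc': "set (scanned M ?d) \<subseteq> {0, 1}"
      using scanned_holds[OF t(2)] by auto
    have ret: "step M ?d = \<lparr> state = b, cells = cells ?d, head = head ?d\<rparr>"
      using t(1) st[OF sc'] by (auto simp: fun_eq_iff)
    then have "holds (tapes M) (exec p (\<tau>(r := n))) (step M ?d)"
      using t(2) by (simp add: holds_def)
    moreover have "exec p (\<tau>(r := n)) r = n"
      by (simp add: exec_frame[OF r(3)])
    moreover have "state (step M ?d) = b"
      by (simp add: ret)
    ultimately
    obtain t' where
      "state ((step M ^^ t') (step M ?d)) = b + num_states p + 2"
      "holds (tapes M) ((exec p ^^ n) ((exec p (\<tau>(r := n)))(r := 0))) ((step M ^^ t') (step M ?d))"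
      using Suc.IH[of "exec p (\<tau>(r := n))" "step M ?d"] by (metis (no_types))
    moreover have "(exec p (\<tau>(r := n)))(r := 0) = exec p (\<tau>(r := 0))"
      using exec_frame[OF r(3)] by simp
    moreover have "(step M ^^ t') (step M ?d) = (step M ^^ (t' + Suc (t + 1))) d"
      by (simp add: funpow_add funpow_swap1)
    ultimately show ?case
      by (intro exI[of _ "t' + Suc (t + 1)"]) (simp add: funpow_swap1 del: fun_upd_apply)
  qed
  from this[OF Loop.prems(4,5) refl] show ?case by simp
qed

text \<open>
  The exit state of the whole program has no transitions, so arriving there means halting.
\<close>

lemma outputs_machine:
  assumes "wf_prog p"
    and out: "\<And>\<sigma>. (\<forall>i. i \<notin> {1..length xs} \<longrightarrow> \<sigma> i = 0) \<Longrightarrow> (\<forall>i\<in>{1..length xs}. \<sigma> i = xs ! (i - 1)) \<Longrightarrow>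
        exec p \<sigma> 0 = y"
    and T: "length xs < T" "regs p \<subseteq> {..<T}"
  shows "outputs (machine T p) xs y"
proof -
  let ?M = "machine T p"
  define \<sigma> where "\<sigma> i = (if i \<in> {1..length xs} then xs ! (i - 1) else 0)" for i
  have tapes: "tapes ?M = T" by (simp add: machine_def)
  have "holds T \<sigma> (initial xs)"
    by (auto simp: holds_def tape_holds_def initial_def \<sigma>_def unary_def fun_eq_iff)
  moreover have "follows ?M p 0"
    by (auto simp: follows_def machine_def)
  ultimately obtain t where
    t: "state (run ?M xs t) = num_states p" "holds T (exec p \<sigma>) (run ?M xs t)"
    using machine_executes[of p ?M 0 \<sigma> "initial xs"] assms
    by (auto simp: tapes run_def initial_def)
  have "exec p \<sigma> 0 = y"
    by (rule out) (auto simp: \<sigma>_def)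
  moreover have "cells (run ?M xs t) 0 = unary (exec p \<sigma> 0)"
    using t(2) T by (auto simp: holds_def tape_holds_def)
  moreover have "halted ?M (run ?M xs t)"
    using t(1) by (simp add: halted_def machine_def)
  ultimately show ?thesis
    by (auto simp: outputs_def)
qed

section \<open>Primitive recursive functions are Turing computable\<close>

definition pfst :: "nat \<Rightarrow> nat" where "pfst n = fst (prod_decode n)"
definition psnd :: "nat \<Rightarrow> nat" where "psnd n = snd (prod_decode n)"

lemma pfst_prod_encode [simp]: "pfst (prod_encode (a, b)) = a"
  and psnd_prod_encode [simp]: "psnd (prod_encode (a, b)) = b"
  and prod_encode_pfst_psnd [simp]: "prod_encode (pfst n, psnd n) = n"
  by (simp_all add: pfst_def psnd_def)

text \<open>
  Working with functions of one argument, and coding several arguments into one by the pairing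
  function, avoids arities and tuples of functions: composition has one inner function, and iteration
  with the value and the number of rounds packed into the argument replaces primitive recursion.
\<close>

inductive prim_rec :: "(nat \<Rightarrow> nat) \<Rightarrow> bool" where
  id: "prim_rec (\<lambda>x. x)"
| zero: "prim_rec (\<lambda>x. 0)"
| suc: "prim_rec Suc"
| pfst: "prim_rec pfst"
| psnd: "prim_rec psnd"
| pair: "prim_rec f \<Longrightarrow> prim_rec g \<Longrightarrow> prim_rec (\<lambda>x. prod_encode (f x, g x))"
| comp: "prim_rec f \<Longrightarrow> prim_rec g \<Longrightarrow> prim_rec (\<lambda>x. f (g x))"
| iter: "prim_rec h \<Longrightarrow> prim_rec (\<lambda>x. (h ^^ psnd x) (pfst x))"

text \<open>
  The program works in place: the registers beyond \<open>r\<close> are scratch space, zero before and after,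
  and those below \<open>r\<close> are not touched. Hence a caller can store intermediate values below the
  register on which it runs a subprogram.
\<close>

definition realizes :: "prog \<Rightarrow> (nat \<Rightarrow> nat) \<Rightarrow> nat \<Rightarrow> bool" where
  "realizes p f r \<longleftrightarrow> wf_prog p \<and> regs p \<subseteq> {r..} \<and>
     (\<forall>\<sigma>. (\<forall>i>r. \<sigma> i = 0) \<longrightarrow> exec p \<sigma> = \<sigma>(r := f (\<sigma> r)))"

abbreviation clear :: "nat \<Rightarrow> prog" where "clear a \<equiv> Loop a Skip"
abbreviation add_to :: "nat \<Rightarrow> nat \<Rightarrow> prog" where "add_to a b \<equiv> Loop a (Inc b)"
abbreviation add_to2 :: "nat \<Rightarrow> nat \<Rightarrow> nat \<Rightarrow> prog" where
  "add_to2 a b c \<equiv> Loop a (Seq (Inc b) (Inc c))"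

lemma exec_clear: "exec (clear a) \<sigma> = \<sigma>(a := 0)"
proof -
  have "(exec Skip ^^ n) \<tau> = \<tau>" for n \<tau> by (induction n) auto
  then show ?thesis by simp
qed

lemma exec_add_to: "a \<noteq> b \<Longrightarrow> exec (add_to a b) \<sigma> = \<sigma>(b := \<sigma> b + \<sigma> a, a := 0)"
proof -
  assume "a \<noteq> b"
  have "(exec (Inc b) ^^ n) \<tau> = \<tau>(b := \<tau> b + n)" for n \<tau> by (induction n) auto
  then show ?thesis using \<open>a \<noteq> b\<close> by (auto simp: fun_eq_iff)
qed

lemma exec_add_to2:
  assumes "a \<noteq> b" "a \<noteq> c" "b \<noteq> c"
  shows "exec (add_to2 a b c) \<sigma> = \<sigma>(b := \<sigma> b + \<sigma> a, c := \<sigma> c + \<sigma> a, a := 0)"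
proof -
  have "(exec (Seq (Inc b) (Inc c)) ^^ n) \<tau> = \<tau>(b := \<tau> b + n, c := \<tau> c + n)" for n \<tau>
    using assms by (induction n) (auto simp: fun_eq_iff)
  then show ?thesis using assms by (auto simp: fun_eq_iff)
qed

text \<open>
  With \<open>r + 3\<close> counting the rounds, each round adds the new count to \<open>r + 2\<close>, so that the rounds
  sum up to a triangular number as in \<open>prod_encode (m, n) = triangle (m + n) + m\<close>.
\<close>

definition triangle_body :: "nat \<Rightarrow> prog" where
  "triangle_body r = Seq (Inc (r + 3)) (Seq (add_to2 (r + 3) (r + 2) (r + 4)) (add_to (r + 4) (r + 3)))"

definition pair_prog :: "nat \<Rightarrow> prog" where
  "pair_prog r =
     Seq (add_to2 r (r + 1) (r + 2))
    (Seq (Loop (r + 1) (triangle_body r))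
    (Seq (clear (r + 3)) (add_to (r + 2) r)))"

lemma exec_triangle_body:
  assumes "\<sigma> (r + 3) = 0" "\<sigma> (r + 4) = 0"
  shows "(exec (triangle_body r) ^^ n) \<sigma> = \<sigma>(r + 3 := n, r + 2 := \<sigma> (r + 2) + triangle n)"
proof (induction n)
  case 0
  then show ?case using assms by (auto simp: fun_eq_iff)
next
  case (Suc n)
  then show ?case using assms
    by (auto simp: fun_eq_iff triangle_body_def exec_add_to exec_add_to2 simp del: exec.simps(5))
qed

lemma exec_pair_prog:
  assumes "\<forall>i>r + 1. \<sigma> i = 0"
  shows "exec (pair_prog r) \<sigma> = \<sigma>(r := prod_encode (\<sigma> r, \<sigma> (r + 1)), r + 1 := 0)"
proof -
  define \<tau> where "\<tau> = exec (add_to2 r (r + 1) (r + 2)) \<sigma>"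
  have \<tau>: "\<tau> = \<sigma>(r := 0, r + 1 := \<sigma> r + \<sigma> (r + 1), r + 2 := \<sigma> r)"
    using assms by (auto simp: \<tau>_def exec_add_to2 fun_eq_iff simp del: exec.simps(5))
  define \<tau>' where "\<tau>' = exec (Loop (r + 1) (triangle_body r)) \<tau>"
  have "\<tau>' = \<tau>(r + 1 := 0, r + 3 := \<sigma> r + \<sigma> (r + 1), r + 2 := \<sigma> r + triangle (\<sigma> r + \<sigma> (r + 1)))"
    using assms by (simp add: \<tau>'_def \<tau> exec_triangle_body) 
  moreover have "exec (pair_prog r) \<sigma> = exec (Seq (clear (r + 3)) (add_to (r + 2) r)) \<tau>'"
    by (simp add: pair_prog_def \<tau>_def \<tau>'_def del: exec.simps(5))
  ultimately show ?thesis using assms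
    by (auto simp: exec_clear exec_add_to \<tau> prod_encode_def fun_eq_iff simp del: exec.simps(5))
qed

lemma wf_pair_prog: "0 < r \<Longrightarrow> wf_prog (pair_prog r)"
  and regs_pair_prog: "regs (pair_prog r) \<subseteq> {r..}"
  by (auto simp: pair_prog_def triangle_body_def)

text \<open>
  The pairing function enumerates the pairs along the antidiagonals; this is the step from one
  pair to the next one, by which a program can decode a number without division.
\<close>

lemma prod_decode_Suc:
  "prod_decode (Suc n) =
     (if psnd n = 0 then (0, Suc (pfst n)) else (Suc (pfst n), psnd n - 1))"
proof -
  have "Suc n = prod_encode (if psnd n = 0 then (0, Suc (pfst n)) else (Suc (pfst n), psnd n - 1))"
    using prod_encode_pfst_psnd[of n] by (cases "psnd n") (auto simp: prod_encode_def)
  then show ?thesis by (metis prod_encode_inverse)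
qed

text \<open>
  Registers \<open>r + 1\<close> and \<open>r + 2\<close> hold the current pair. The body branches on whether the second
  component is zero: \<open>r + 3\<close> ends up as the flag for this case and \<open>r + 5\<close> as its negation,
  while the new second component is assembled in \<open>r + 4\<close>, with one unit too many in both cases.
\<close>

definition succ_pair_body :: "nat \<Rightarrow> prog" where
  "succ_pair_body r =
     Seq (Inc (r + 3)) (Seq (Inc (r + 5))
    (Seq (Loop (r + 2) (Seq (Inc (r + 4)) (Dec (r + 3))))
    (Seq (Loop (r + 3) (Seq (Dec (r + 5)) (Seq (add_to (r + 1) (r + 4)) (Seq (Inc (r + 4)) (Inc (r + 4))))))
    (Seq (Dec (r + 4)) (Seq (add_to (r + 5) (r + 1)) (add_to (r + 4) (r + 2)))))))"

definition unpair_prog :: "nat \<Rightarrow> prog" where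
  "unpair_prog r = Seq (Loop r (succ_pair_body r)) (add_to (r + 2) r)"

lemma exec_succ_pair_body:
  assumes "\<forall>i>r + 2. \<sigma> i = 0"
  shows "exec (succ_pair_body r) \<sigma> =
    (if \<sigma> (r + 2) = 0 then \<sigma>(r + 1 := 0, r + 2 := Suc (\<sigma> (r + 1)))
     else \<sigma>(r + 1 := Suc (\<sigma> (r + 1)), r + 2 := \<sigma> (r + 2) - 1))"
proof -
  let ?zero_case = "Seq (Dec (r + 5)) (Seq (add_to (r + 1) (r + 4)) (Seq (Inc (r + 4)) (Inc (r + 4))))"
  define \<tau> where "\<tau> = exec (Seq (Inc (r + 3)) (Seq (Inc (r + 5))
      (Loop (r + 2) (Seq (Inc (r + 4)) (Dec (r + 3)))))) \<sigma>"
  have "(exec (Seq (Inc (r + 4)) (Dec (r + 3))) ^^ n) \<rho> = \<rho>(r + 4 := \<rho> (r + 4) + n, r + 3 := \<rho> (r + 3) - n)" for n \<rho>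
    by (induction n) (auto simp: fun_eq_iff)
  then have \<tau>: "\<tau> = \<sigma>(r + 2 := 0, r + 3 := 1 - \<sigma> (r + 2), r + 4 := \<sigma> (r + 2), r + 5 := 1)"
    using assms by (auto simp: \<tau>_def fun_eq_iff)
  have 1: "exec (succ_pair_body r) \<sigma> = exec (Seq (Loop (r + 3) ?zero_case)
    (Seq (Dec (r + 4)) (Seq (add_to (r + 5) (r + 1)) (add_to (r + 4) (r + 2))))) \<tau>"
    by (simp add: succ_pair_body_def \<tau>_def del: exec.simps(5))
  show ?thesis
  proof (cases "\<sigma> (r + 2)")
    case 0
    have "exec (Loop (r + 3) ?zero_case) \<tau>
      = exec ?zero_case (\<tau>(r + 3 := 0))"
      using 0 by (subst exec.simps(5)) (simp add: \<tau> del: exec.simps)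
    with 0 assms show ?thesis unfolding 1
      by (auto simp: \<tau> exec_add_to fun_eq_iff simp del: exec.simps(5))
  next
    case (Suc m)
    have "exec (Loop (r + 3) ?zero_case) \<tau> = \<tau>"
      using Suc by (auto simp: \<tau> fun_eq_iff)
    with Suc assms show ?thesis unfolding 1
      by (auto simp: \<tau> exec_add_to fun_eq_iff simp del: exec.simps(5))
  qed
qed

lemma exec_unpair_prog:
  assumes "\<forall>i>r. \<sigma> i = 0"
  shows "exec (unpair_prog r) \<sigma> = \<sigma>(r := psnd (\<sigma> r), r + 1 := pfst (\<sigma> r))"
proof -
  have "(exec (succ_pair_body r) ^^ n) (\<sigma>(r := 0)) = \<sigma>(r := 0, r + 1 := pfst n, r + 2 := psnd n)" for n
  proof (induction n)
    case 0
    have "pfst 0 = 0" "psnd 0 = 0"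
      by (simp_all add: pfst_def psnd_def prod_decode_def prod_decode_aux.simps)
    then show ?case using assms by (auto simp: fun_eq_iff)
  next
    case (Suc n)
    then show ?case using assms
      by (auto simp: exec_succ_pair_body fun_eq_iff pfst_def[of "Suc n"] psnd_def[of "Suc n"] prod_decode_Suc)
  qed
  then have "exec (Loop r (succ_pair_body r)) \<sigma> = \<sigma>(r := 0, r + 1 := pfst (\<sigma> r), r + 2 := psnd (\<sigma> r))"
    by simp
  then show ?thesis using assms
    by (auto simp: unpair_prog_def exec_add_to fun_eq_iff simp del: exec.simps(5))
qed

lemma wf_unpair_prog: "0 < r \<Longrightarrow> wf_prog (unpair_prog r)"
  and regs_unpair_prog: "regs (unpair_prog r) \<subseteq> {r..}"
  by (auto simp: unpair_prog_def succ_pair_body_def)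

text \<open>
  For a pair, the argument is duplicated and the two functions are evaluated one after the
  other, each on the last register in use, where the scratch space is free. For an iteration,
  the unpacked counter stays in \<open>r\<close> and controls a loop that acts on \<open>r + 1\<close>.
\<close>

lemma prim_rec_realized:
  assumes "prim_rec f" "0 < r"
  shows "\<exists>p. realizes p f r"
  using assms
proof (induction arbitrary: r)
  case id
  show ?case by (rule exI[of _ Skip]) (simp add: realizes_def)
next
  case zero
  then show ?case by (intro exI[of _ "clear r"]) (simp add: realizes_def exec_clear del: exec.simps)
next
  case suc
  show ?case by (rule exI[of _ "Inc r"]) (simp add: realizes_def)
next
  case pfst
  have "realizes (Seq (unpair_prog r) (Seq (clear r) (add_to (r + 1) r))) pfst r"
    using pfst wf_unpair_prog regs_unpair_prog[of r]
    by (auto simp: realizes_def exec_unpair_prog exec_clear exec_add_to fun_eq_iff simp del: exec.simps(5))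
  then show ?case ..
next
  case psnd
  have "realizes (Seq (unpair_prog r) (clear (r + 1))) psnd r"
    using psnd wf_unpair_prog regs_unpair_prog[of r]
    by (auto simp: realizes_def exec_unpair_prog exec_clear fun_eq_iff simp del: exec.simps(5))
  then show ?case ..
next
  case (pair f g)
  obtain p where p: "realizes p f (r + 2)" using pair.IH(1)[of "r + 2"] by auto
  obtain p' where p': "realizes p' g (r + 1)" using pair.IH(2)[of "r + 1"] by auto
  let ?p = "Seq (add_to2 r (r + 1) (r + 2)) (Seq p (Seq (add_to (r + 2) r) (Seq p' (pair_prog r))))"
  have "exec ?p \<sigma> = \<sigma>(r := prod_encode (f (\<sigma> r), g (\<sigma> r)))" if "\<forall>i>r. \<sigma> i = 0" for \<sigma>
  proof -
    have "exec (add_to2 r (r + 1) (r + 2)) \<sigma> = \<sigma>(r := 0, r + 1 := \<sigma> r, r + 2 := \<sigma> r)"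
      using that by (auto simp: exec_add_to2 fun_eq_iff simp del: exec.simps(5))
    moreover have "exec p (\<sigma>(r := 0, r + 1 := \<sigma> r, r + 2 := \<sigma> r)) =
        \<sigma>(r := 0, r + 1 := \<sigma> r, r + 2 := f (\<sigma> r))"
      using p that by (auto simp: realizes_def)
    moreover have "exec (add_to (r + 2) r) (\<sigma>(r := 0, r + 1 := \<sigma> r, r + 2 := f (\<sigma> r))) =
        \<sigma>(r := f (\<sigma> r), r + 1 := \<sigma> r)"
      using that by (auto simp: exec_add_to fun_eq_iff simp del: exec.simps(5))
    moreover have "exec p' (\<sigma>(r := f (\<sigma> r), r + 1 := \<sigma> r)) = \<sigma>(r := f (\<sigma> r), r + 1 := g (\<sigma> r))"
      using p' that by (auto simp: realizes_def)
    moreover have "exec (pair_prog r) (\<sigma>(r := f (\<sigma> r), r + 1 := g (\<sigma> r))) =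
        \<sigma>(r := prod_encode (f (\<sigma> r), g (\<sigma> r)))"
      using that by (subst exec_pair_prog) (auto simp: fun_eq_iff)
    ultimately show ?thesis by simp
  qed
  moreover have "regs p \<subseteq> {r..}" "regs p' \<subseteq> {r..}"
    using p p' by (auto simp: realizes_def)
  ultimately have "realizes ?p (\<lambda>x. prod_encode (f x, g x)) r"
    using p p' pair.prems regs_pair_prog[of r]
    by (auto simp: realizes_def wf_pair_prog simp del: exec.simps)
  then show ?case ..
next
  case (comp f g)
  obtain p p' where "realizes p f r" "realizes p' g r" using comp by blast
  then have "realizes (Seq p' p) (\<lambda>x. f (g x)) r" by (auto simp: realizes_def)
  then show ?case ..
next
  case (iter h)
  obtain p where p: "realizes p h (r + 1)" using iter.IH[of "r + 1"] by auto
  let ?p = "Seq (unpair_prog r) (Seq (Loop r p) (add_to (r + 1) r))"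
  have "exec ?p \<sigma> = \<sigma>(r := (h ^^ psnd (\<sigma> r)) (pfst (\<sigma> r)))" if "\<forall>i>r. \<sigma> i = 0" for \<sigma>
  proof -
    have "(exec p ^^ n) (\<sigma>(r := 0, r + 1 := m)) = \<sigma>(r := 0, r + 1 := (h ^^ n) m)" for m n
      by (induction n) (use p that in \<open>auto simp: realizes_def\<close>)
    then have "exec (Loop r p) (\<sigma>(r := n, r + 1 := m)) = \<sigma>(r := 0, r + 1 := (h ^^ n) m)" for m n
      by (simp add: fun_upd_twist)
    moreover have "exec (add_to (r + 1) r) (\<sigma>(r := 0, r + 1 := m)) = \<sigma>(r := m)" for m
      using that by (auto simp: exec_add_to fun_eq_iff simp del: exec.simps(5))
    ultimately show ?thesis
      using that by (simp add: exec_unpair_prog del: exec.simps(5))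
  qed
  moreover have "r \<notin> regs p" "regs p \<subseteq> {r..}"
    using p by (auto simp: realizes_def)
  ultimately have "realizes ?p (\<lambda>x. (h ^^ psnd x) (pfst x)) r"
    using p iter.prems regs_unpair_prog[of r]
    by (auto simp: realizes_def wf_unpair_prog simp del: exec.simps)
  then show ?case ..
qed

theorem turing_computes_prim_rec:
  assumes "prim_rec f"
  shows "\<exists>M. turing_machine M \<and> (\<forall>i j. outputs M [i, j] (f (prod_encode (i, j))))"
proof -
  obtain p where p: "realizes p f 1" using prim_rec_realized[OF assms, of 1] by auto
  let ?p = "Seq (pair_prog 1) (Seq p (add_to 1 0))"
  obtain T where T: "regs ?p \<subseteq> {..<T}" using regs_bounded ..
  let ?T = "T + 3"
  have "outputs (machine ?T ?p) [i, j] (f (prod_encode (i, j)))" for i j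
  proof (rule outputs_machine)
    show "wf_prog ?p" using p by (auto simp: realizes_def wf_pair_prog)
    show "length [i, j] < ?T" "regs ?p \<subseteq> {..<?T}" using T by auto
    fix \<sigma> :: "nat \<Rightarrow> nat"
    assume 0: "\<forall>k. k \<notin> {1..length [i, j]} \<longrightarrow> \<sigma> k = 0"
      and 1: "\<forall>k\<in>{1..length [i, j]}. \<sigma> k = [i, j] ! (k - 1)"
    have \<sigma>: "\<sigma> 1 = i" "\<sigma> 2 = j" "\<sigma> 0 = 0" "\<forall>k>2. \<sigma> k = 0" using 0 1 by auto
    have "exec (pair_prog 1) \<sigma> = \<sigma>(1 := prod_encode (i, j), 2 := 0)"
      using exec_pair_prog[of 1 \<sigma>] \<sigma> by (auto simp: numeral_2_eq_2)
    moreover have "exec p (\<sigma>(1 := prod_encode (i, j), 2 := 0)) =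
        \<sigma>(1 := f (prod_encode (i, j)), 2 := 0)"
    proof -
      have "\<forall>k>1. (\<sigma>(1 := prod_encode (i, j), 2 := 0)) k = 0" using \<sigma>(4) by auto
      then have "exec p (\<sigma>(1 := prod_encode (i, j), 2 := 0)) =
          (\<sigma>(1 := prod_encode (i, j), 2 := 0))(1 := f (prod_encode (i, j)))"
        using p by (auto simp: realizes_def simp del: fun_upd_apply) (simp add: fun_upd_twist)
      then show ?thesis by (auto simp: fun_eq_iff)
    qed
    ultimately show "exec ?p \<sigma> 0 = f (prod_encode (i, j))"
      using \<sigma> by (simp add: exec_add_to del: exec.simps(5))
  qed
  moreover have "turing_machine (machine ?T ?p)" by (rule turing_machine_machine) simp
  ultimately show ?thesis by blast
qed

section \<open>Closure properties of primitive recursion\<close>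

text \<open>
  The rules have the form in which \<open>intro\<close> decomposes a function given by an expression. A
  function with parameters that is itself an argument, such as the body of a recursion, is
  uncurried with \<open>pfst\<close> and \<open>psnd\<close> in the premise.
\<close>

named_theorems prim_rec_intros

abbreviation prim_rec_pred :: "(nat \<Rightarrow> bool) \<Rightarrow> bool" where
  "prim_rec_pred P \<equiv> prim_rec (\<lambda>x. of_bool (P x))"

lemma prim_rec_const [prim_rec_intros]: "prim_rec (\<lambda>x. c)"
  by (induction c) (auto intro: prim_rec.zero prim_rec.comp[OF prim_rec.suc])

lemmas prim_rec_id [prim_rec_intros] = prim_rec.id
  and prim_rec_pair [prim_rec_intros] = prim_rec.pair
  and prim_rec_Suc [prim_rec_intros] = prim_rec.comp[OF prim_rec.suc]
  and prim_rec_pfst [prim_rec_intros] = prim_rec.comp[OF prim_rec.pfst]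
  and prim_rec_psnd [prim_rec_intros] = prim_rec.comp[OF prim_rec.psnd]

text \<open>
  The parameter \<open>x\<close> is carried along as the first component of the iterated pair.
\<close>

lemma prim_rec_funpow [prim_rec_intros]:
  assumes h: "prim_rec (\<lambda>z. h (pfst z) (psnd z))" and g: "prim_rec g" and m: "prim_rec m"
  shows "prim_rec (\<lambda>x. (h x ^^ m x) (g x))"
proof -
  define H where "H z = prod_encode (pfst z, h (pfst z) (psnd z))" for z
  have H: "(H ^^ n) (prod_encode (x, r)) = prod_encode (x, (h x ^^ n) r)" for n x r
    by (induction n) (auto simp: H_def)
  have "prim_rec H" unfolding H_def by (intro h prim_rec_intros)
  from prim_rec.comp[OF prim_rec.iter[OF this], of "\<lambda>x. prod_encode (prod_encode (x, g x), m x)"]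
  have "prim_rec (\<lambda>x. (H ^^ m x) (prod_encode (x, g x)))"
    by (simp add: g m prim_rec_intros)
  then have "prim_rec (\<lambda>x. psnd ((H ^^ m x) (prod_encode (x, g x))))"
    by (intro prim_rec_intros)
  then show ?thesis by (simp add: H)
qed

text \<open>
  The recursion is an iteration on pairs of the number of rounds and the current value.
\<close>

lemma prim_rec_rec_nat [prim_rec_intros]:
  assumes h: "prim_rec (\<lambda>z. h (pfst z) (pfst (psnd z)) (psnd (psnd z)))"
    and g: "prim_rec g" and m: "prim_rec m"
  shows "prim_rec (\<lambda>x. rec_nat (g x) (h x) (m x))"
proof -
  define H where "H x z = prod_encode (Suc (pfst z), h x (pfst z) (psnd z))" for x z
  have H: "(H x ^^ n) (prod_encode (0, r)) = prod_encode (n, rec_nat r (h x) n)" for n x r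
    by (induction n) (auto simp: H_def)
  have "prim_rec (\<lambda>x. psnd ((H x ^^ m x) (prod_encode (0, g x))))"
    unfolding H_def by (intro h g m prim_rec_intros)
  then show ?thesis by (simp add: H)
qed

lemma prim_rec_add [prim_rec_intros]:
  assumes "prim_rec f" "prim_rec g"
  shows "prim_rec (\<lambda>x. f x + g x)"
proof -
  have "prim_rec (\<lambda>x. (Suc ^^ g x) (f x))" by (intro assms prim_rec_intros)
  then show ?thesis by (simp add: add.commute)
qed

lemma prim_rec_mult [prim_rec_intros]:
  assumes "prim_rec f" "prim_rec g"
  shows "prim_rec (\<lambda>x. f x * g x)"
proof -
  have "((\<lambda>r. r + a) ^^ n) 0 = a * n" for a n :: nat by (induction n) auto
  moreover have "prim_rec (\<lambda>x. ((\<lambda>r. r + f x) ^^ g x) 0)"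
    by (intro assms prim_rec_intros prim_rec.comp[OF assms(1)])
  ultimately show ?thesis by simp
qed

lemma prim_rec_power [prim_rec_intros]:
  assumes "prim_rec f" "prim_rec g"
  shows "prim_rec (\<lambda>x. f x ^ g x)"
proof -
  have "((\<lambda>r. r * a) ^^ n) 1 = a ^ n" for a n :: nat by (induction n) auto
  moreover have "prim_rec (\<lambda>x. ((\<lambda>r. r * f x) ^^ g x) 1)"
    by (intro assms prim_rec_intros prim_rec.comp[OF assms(1)])
  ultimately show ?thesis by simp
qed

lemma prim_rec_diff [prim_rec_intros]:
  assumes "prim_rec f" "prim_rec g"
  shows "prim_rec (\<lambda>x. f x - g x)"
proof -
  have pred: "rec_nat 0 (\<lambda>n r. n) m = m - 1" for m :: nat by (cases m) auto
  have "((\<lambda>r. r - 1) ^^ n) a = a - n" for a n :: nat by (induction n) auto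
  moreover have "prim_rec (\<lambda>x. ((\<lambda>r. rec_nat 0 (\<lambda>n r. n) r) ^^ g x) (f x))"
    by (intro assms prim_rec_intros)
  ultimately show ?thesis by (simp add: pred)
qed

lemma prim_rec_le [prim_rec_intros]:
  assumes "prim_rec f" "prim_rec g"
  shows "prim_rec_pred (\<lambda>x. f x \<le> g x)"
proof -
  have "prim_rec (\<lambda>x. 1 - (f x - g x))" by (intro assms prim_rec_intros)
  also have "(\<lambda>x. 1 - (f x - g x)) = (\<lambda>x. of_bool (f x \<le> g x))" by (auto simp: fun_eq_iff)
  finally show ?thesis .
qed

lemma prim_rec_less [prim_rec_intros]:
  "prim_rec f \<Longrightarrow> prim_rec g \<Longrightarrow> prim_rec_pred (\<lambda>x. f x < g x)"
  unfolding Suc_le_eq[symmetric] by (intro prim_rec_intros)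

lemma prim_rec_not [prim_rec_intros]:
  assumes "prim_rec_pred P"
  shows "prim_rec_pred (\<lambda>x. \<not> P x)"
proof -
  have "prim_rec (\<lambda>x. 1 - of_bool (P x))" by (intro assms prim_rec_intros)
  also have "(\<lambda>x. 1 - of_bool (P x)) = (\<lambda>x. of_bool (\<not> P x) :: nat)" by (auto simp: fun_eq_iff)
  finally show ?thesis .
qed

lemma prim_rec_conj [prim_rec_intros]:
  assumes "prim_rec_pred P" "prim_rec_pred Q"
  shows "prim_rec_pred (\<lambda>x. P x \<and> Q x)"
  using prim_rec_mult[OF assms] by (simp add: of_bool_conj)

lemma prim_rec_disj [prim_rec_intros]:
  assumes "prim_rec_pred P" "prim_rec_pred Q"
  shows "prim_rec_pred (\<lambda>x. P x \<or> Q x)"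
proof -
  have "prim_rec_pred (\<lambda>x. \<not> (\<not> P x \<and> \<not> Q x))" by (intro assms prim_rec_intros)
  then show ?thesis by simp
qed

lemma prim_rec_eq [prim_rec_intros]:
  assumes "prim_rec f" "prim_rec g"
  shows "prim_rec_pred (\<lambda>x. f x = g x)"
proof -
  have "prim_rec_pred (\<lambda>x. f x \<le> g x \<and> g x \<le> f x)" by (intro assms prim_rec_intros)
  then show ?thesis by (simp add: antisym_conv order_eq_iff)
qed

lemma prim_rec_if [prim_rec_intros]:
  assumes "prim_rec_pred P" "prim_rec f" "prim_rec g"
  shows "prim_rec (\<lambda>x. if P x then f x else g x)"
proof -
  have "prim_rec (\<lambda>x. of_bool (P x) * f x + (1 - of_bool (P x)) * g x)"
    by (intro assms prim_rec_intros)
  also have "(\<lambda>x. of_bool (P x) * f x + (1 - of_bool (P x)) * g x) = (\<lambda>x. if P x then f x else g x)"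
    by auto
  finally show ?thesis .
qed

lemma prim_rec_ball [prim_rec_intros]:
  assumes "prim_rec_pred (\<lambda>z. P (pfst z) (psnd z))" "prim_rec b"
  shows "prim_rec_pred (\<lambda>x. \<forall>i<b x. P x i)"
proof -
  have P: "prim_rec_pred (\<lambda>z. P (pfst z) (pfst (psnd z)))"
    using prim_rec.comp[OF assms(1), of "\<lambda>z. prod_encode (pfst z, pfst (psnd z))"]
    by (simp add: prim_rec_intros prim_rec.pfst)
  have "rec_nat 1 (\<lambda>i r. of_bool (P x i) * r) n = (of_bool (\<forall>i<n. P x i) :: nat)" for n x
    by (induction n) (auto simp: less_Suc_eq)
  moreover have "prim_rec (\<lambda>x. rec_nat 1 (\<lambda>i r. of_bool (P x i) * r) (b x))"
    by (intro assms(2) P prim_rec_intros)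
  ultimately show ?thesis by simp
qed

lemma prim_rec_even [prim_rec_intros]:
  assumes "prim_rec f"
  shows "prim_rec_pred (\<lambda>x. even (f x))"
proof -
  have "((\<lambda>r. 1 - r) ^^ n) 1 = (of_bool (even n) :: nat)" for n by (induction n) auto
  moreover have "prim_rec (\<lambda>x. ((\<lambda>r. 1 - r) ^^ f x) 1)" by (intro assms prim_rec_intros)
  ultimately show ?thesis by simp
qed

lemma prim_rec_half [prim_rec_intros]:
  assumes "prim_rec f"
  shows "prim_rec (\<lambda>x. f x div 2)"
proof -
  have "rec_nat 0 (\<lambda>n r. if even n then r else Suc r) n = n div 2" for n :: nat
    by (induction n) auto
  moreover have "prim_rec (\<lambda>x. rec_nat 0 (\<lambda>n r. if even n then r else Suc r) (f x))"
    by (intro assms prim_rec_intros)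
  ultimately show ?thesis by simp
qed

lemma prim_rec_set_decode [prim_rec_intros]:
  assumes "prim_rec f" "prim_rec g"
  shows "prim_rec_pred (\<lambda>x. f x \<in> set_decode (g x))"
proof -
  have *: "((\<lambda>r. r div 2) ^^ n) m = m div 2 ^ n" for m n :: nat
    by (induction n) (auto simp: div_mult2_eq[symmetric] mult.commute)
  have "prim_rec_pred (\<lambda>x. \<not> even (((\<lambda>r. r div 2) ^^ f x) (g x)))"
    by (intro assms prim_rec_intros)
  then show ?thesis unfolding * by (simp add: set_decode_def)
qed

section \<open>Sequences coded by numbers\<close>

text \<open>
  A number is read as an infinite sequence that is eventually zero: its first component is the
  head and its second component the tail. As \<open>0\<close> codes the pair \<open>(0, 0)\<close>, the number \<open>0\<close> codes
  the zero sequence, so no length needs to be stored. This suits the tapes of a machine, which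
  are blank outside a finite part.
\<close>

definition entry :: "nat \<Rightarrow> nat \<Rightarrow> nat" where
  "entry s k = pfst ((psnd ^^ k) s)"

lemma prim_rec_entry [prim_rec_intros]:
  "prim_rec f \<Longrightarrow> prim_rec g \<Longrightarrow> prim_rec (\<lambda>x. entry (f x) (g x))"
  unfolding entry_def by (intro prim_rec_intros)

lemma entry_0: "entry s 0 = pfst s"
  and entry_Suc: "entry s (Suc k) = entry (psnd s) k"
  by (simp_all add: entry_def funpow_swap1)

lemma entry_prod_encode: "entry (prod_encode (a, s)) k = (case k of 0 \<Rightarrow> a | Suc k \<Rightarrow> entry s k)"
  by (simp add: entry_0 entry_Suc split: nat.split)

text \<open>
  Choice for finitely many witnesses: they can be collected into one number.
\<close>

lemma exists_entries: "\<exists>s. \<forall>i<n. entry s i = v i"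
proof (induction n arbitrary: v)
  case (Suc n)
  from Suc[of "\<lambda>i. v (Suc i)"] obtain s where s: "\<forall>i<n. entry s i = v (Suc i)" by blast
  then show ?case
    by (intro exI[of _ "prod_encode (v 0, s)"]) (auto simp: entry_prod_encode split: nat.split)
qed simp

text \<open>
  The tail of \<open>s\<close> is smaller than \<open>s\<close>, except that \<open>0\<close> and \<open>1\<close> are their own tails; both of them
  code the zero sequence. A bound on the support makes the equality of a coded tape with a given
  unary number decidable.
\<close>

lemma entry_beyond: "s \<le> k \<Longrightarrow> entry s k = 0"
proof (induction k arbitrary: s)
  case 0
  then show ?case by (simp add: entry_0 pfst_def prod_decode_def prod_decode_aux.simps)
next
  case (Suc k)
  show ?case
  proof (cases "psnd s \<le> k")
    case True
    then show ?thesis using Suc.IH by (simp add: entry_Suc)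
  next
    case False
    have s: "s = triangle (pfst s + psnd s) + pfst s"
      using prod_encode_pfst_psnd[of s] by (simp add: prod_encode_def)
    have tri: "n \<le> triangle n" "2 \<le> n \<Longrightarrow> Suc n \<le> triangle n" for n
      by (induction n) (auto simp: le_Suc_eq)
    have "psnd s = s" "pfst s = 0" "psnd s \<le> 1"
      using False Suc.prems s tri[of "pfst s + psnd s"] by linarith+
    moreover have "entry 0 k = 0" for k using calculation
      by (induction k) (simp_all add: entry_0 entry_Suc pfst_def psnd_def prod_decode_def prod_decode_aux.simps)
    moreover have "entry 1 k = 0" for k
      by (induction k) (simp_all add: entry_0 entry_Suc pfst_def psnd_def prod_decode_def prod_decode_aux.simps)
    ultimately show ?thesis by (metis One_nat_def le_Suc_eq le_zero_eq)
  qed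
qed

text \<open>
  Updating a position by primitive recursion uses a zipper: the pair consists of the entries
  passed so far, in reverse order, and the remaining sequence. Descend to the position, replace
  the head, and ascend again.
\<close>

definition zip_down :: "nat \<Rightarrow> nat" where
  "zip_down z = prod_encode (prod_encode (pfst (psnd z), pfst z), psnd (psnd z))"

definition zip_up :: "nat \<Rightarrow> nat" where
  "zip_up z = prod_encode (psnd (pfst z), prod_encode (pfst (pfst z), psnd z))"

definition zip_set :: "nat \<Rightarrow> nat \<Rightarrow> nat" where
  "zip_set v z = prod_encode (pfst z, prod_encode (v, psnd (psnd z)))"

definition set_entry :: "nat \<Rightarrow> nat \<Rightarrow> nat \<Rightarrow> nat" where
  "set_entry s k v = psnd ((zip_up ^^ k) (zip_set v ((zip_down ^^ k) (prod_encode (0, s)))))"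

lemma prim_rec_set_entry [prim_rec_intros]:
  "prim_rec f \<Longrightarrow> prim_rec g \<Longrightarrow> prim_rec h \<Longrightarrow> prim_rec (\<lambda>x. set_entry (f x) (g x) (h x))"
  unfolding set_entry_def zip_down_def zip_up_def zip_set_def by (intro prim_rec_intros)

lemma entry_set_entry: "entry (set_entry s k v) = (entry s)(k := v)"
proof -
  have "\<exists>t. (zip_up ^^ k) (zip_set v ((zip_down ^^ k) (prod_encode (r, s)))) = prod_encode (r, t)
      \<and> entry t = (entry s)(k := v)" for r
  proof (induction k arbitrary: r s)
    case 0
    show ?case
      by (auto simp: zip_set_def fun_eq_iff entry_prod_encode entry_Suc split: nat.split)
  next
    case (Suc k)
    from Suc[of "prod_encode (pfst s, r)" "psnd s"] obtain t where
      t: "(zip_up ^^ k) (zip_set v ((zip_down ^^ k) (prod_encode (prod_encode (pfst s, r), psnd s)))) =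
          prod_encode (prod_encode (pfst s, r), t)"
        "entry t = (entry (psnd s))(k := v)" by blast
    have "entry (prod_encode (pfst s, t)) = (entry s)(Suc k := v)"
      using t(2) by (auto simp: fun_eq_iff entry_prod_encode entry_0 entry_Suc split: nat.split)
    with t(1) show ?case
      by (auto simp: funpow_swap1[of zip_down] zip_down_def[of "prod_encode (r, s)"] zip_up_def[of "prod_encode _"])
  qed
  from this[of 0] show ?thesis by (auto simp: set_entry_def)
qed

section \<open>Primitive recursive simulation of Turing machines\<close>

text \<open>
  Every number codes a configuration: the state, the sequence of head positions, and one
  sequence for the cells of all tapes, indexed by pairs of tape and position. With absolute
  positions, decoding is a function and commutes with the steps of the machine exactly; no
  simulation relation is needed.
\<close>

definition config_of :: "nat \<Rightarrow> config" where
  "config_of x =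
     \<lparr> state = pfst x,
       cells = (\<lambda>i z. entry (psnd (psnd x)) (prod_encode (i, int_encode z))),
       head = (\<lambda>i. int_decode (entry (pfst (psnd x)) i)) \<rparr>"

text \<open>
  Moves of a head in terms of \<open>int_encode\<close>, which sends \<open>n \<ge> 0\<close> to \<open>2 * n\<close> and \<open>- n < 0\<close> to
  \<open>2 * n - 1\<close>. A move to the right from \<open>-1\<close>, coded as \<open>1\<close>, reaches \<open>1 - 2 = 0\<close> by truncated
  subtraction.
\<close>

fun move_code :: "move \<Rightarrow> nat \<Rightarrow> nat" where
  "move_code Stay h = h"
| "move_code Go_Right h = (if even h then h + 2 else h - 2)"
| "move_code Go_Left h = (if even h then if h = 0 then 1 else h - 2 else h + 2)"

lemma int_decode_move_code: "int_decode (move_code m h) = int_decode h + shift m"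
proof (cases "even h")
  case True
  then obtain k where "h = 2 * k" by (elim evenE)
  then show ?thesis
    by (cases m; cases k) (auto simp: int_decode_def sum_decode_def)
next
  case False
  then obtain k where "h = 2 * k + 1" by (elim oddE)
  then show ?thesis
    by (cases m; cases k) (auto simp: int_decode_def sum_decode_def)
qed

lemma prim_rec_move_code [prim_rec_intros]: "prim_rec f \<Longrightarrow> prim_rec (\<lambda>x. move_code m (f x))"
  by (cases m) (auto intro!: prim_rec_intros)

definition tape_act :: "nat \<Rightarrow> nat \<times> move \<Rightarrow> nat \<Rightarrow> nat" where
  "tape_act i a x = prod_encode (pfst x, prod_encode
     (set_entry (pfst (psnd x)) i (move_code (snd a) (entry (pfst (psnd x)) i)),
      set_entry (psnd (psnd x)) (prod_encode (i, entry (pfst (psnd x)) i)) (fst a)))"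

lemma prim_rec_tape_act [prim_rec_intros]: "prim_rec f \<Longrightarrow> prim_rec (\<lambda>x. tape_act i a (f x))"
  unfolding tape_act_def by (intro prim_rec_intros)

lemma config_of_tape_act:
  "config_of (tape_act i a x) = (config_of x)
     \<lparr> cells := (cells (config_of x))(i := (cells (config_of x) i)(head (config_of x) i := fst a)),
       head := (head (config_of x))(i := head (config_of x) i + shift (snd a)) \<rparr>"
proof -
  have "int_encode z = h \<longleftrightarrow> z = int_decode h" for z h by auto
  then show ?thesis
    by (auto simp: config_of_def tape_act_def entry_set_entry int_decode_move_code fun_eq_iff)
qed

lemma transition_code:
  "\<exists>g. prim_rec g \<and> (\<forall>x. config_of (g x) =
     \<lparr> state = q,
       cells = (\<lambda>i. if i < n then (cells (config_of x) i)(head (config_of x) i := fst (w ! i)) else cells (config_of x) i),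
       head = (\<lambda>i. if i < n then head (config_of x) i + shift (snd (w ! i)) else head (config_of x) i) \<rparr>)"
proof (induction n)
  case 0
  show ?case
    by (rule exI[of _ "\<lambda>x. prod_encode (q, psnd x)"], intro conjI prim_rec_intros)
       (auto simp: config_of_def)
next
  case (Suc n)
  then obtain g where "prim_rec g" and
    g: "\<And>x. config_of (g x) = \<lparr> state = q,
       cells = (\<lambda>i. if i < n then (cells (config_of x) i)(head (config_of x) i := fst (w ! i)) else cells (config_of x) i),
       head = (\<lambda>i. if i < n then head (config_of x) i + shift (snd (w ! i)) else head (config_of x) i) \<rparr>" by blast
  show ?case
    by (rule exI[of _ "\<lambda>x. tape_act n (w ! n) (g x)"], intro conjI prim_rec_intros \<open>prim_rec g\<close>)
       (auto simp: config_of_tape_act g fun_eq_iff less_Suc_eq)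
qed

lemma prim_rec_ball_less:
  "(\<And>i::nat. i < n \<Longrightarrow> prim_rec_pred (\<lambda>x. P x i)) \<Longrightarrow> prim_rec_pred (\<lambda>x. \<forall>i<n. P x i)"
proof (induction n)
  case 0
  show ?case by (simp add: prim_rec_const)
next
  case (Suc n)
  then have "prim_rec_pred (\<lambda>x. (\<forall>i<n. P x i) \<and> P x n)" by (intro prim_rec_conj) auto
  then show ?case by (simp add: less_Suc_eq imp_disjL all_conj_distrib)
qed

lemma prim_rec_scanned: "prim_rec_pred (\<lambda>x. (state (config_of x), scanned M (config_of x)) = (q, a))"
proof -
  have "prim_rec_pred (\<lambda>x. pfst x = q \<and> length a = tapes M \<and>
      (\<forall>i<tapes M. entry (psnd (psnd x)) (prod_encode (i, entry (pfst (psnd x)) i)) = a ! i))"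
    by (intro prim_rec_ball_less prim_rec_intros)
  moreover have "(state (config_of x), scanned M (config_of x)) = (q, a) \<longleftrightarrow> pfst x = q \<and> length a = tapes M \<and>
      (\<forall>i<tapes M. entry (psnd (psnd x)) (prod_encode (i, entry (pfst (psnd x)) i)) = a ! i)" for x
    by (auto simp: list_eq_iff_nth_eq config_of_def)
  ultimately show ?thesis by simp
qed

text \<open>
  The transition table is finite, so the step is a finite case distinction, built up by
  induction over the domain of the table.
\<close>

lemma step_code:
  assumes "turing_machine M"
  shows "\<exists>g. prim_rec g \<and> (\<forall>x. config_of (g x) = step M (config_of x))"
proof -
  have "finite D \<Longrightarrow> D \<subseteq> dom (delta M) \<Longrightarrow> \<exists>g. prim_rec g \<and> (\<forall>x. config_of (g x) =
      (if (state (config_of x), scanned M (config_of x)) \<in> D then step M (config_of x) else config_of x))" for D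
  proof (induction rule: finite_induct)
    case empty
    show ?case using prim_rec.id by auto
  next
    case (insert k D)
    then obtain g where g: "prim_rec g" "\<And>x. config_of (g x) =
      (if (state (config_of x), scanned M (config_of x)) \<in> D then step M (config_of x) else config_of x)" by blast
    obtain q' w where k: "delta M k = Some (q', w)" using insert.prems by auto
    obtain q a where qa: "k = (q, a)" by fastforce
    obtain g' where g': "prim_rec g'" "\<And>x. config_of (g' x) =
     \<lparr> state = q',
       cells = (\<lambda>i. if i < tapes M then (cells (config_of x) i)(head (config_of x) i := fst (w ! i)) else cells (config_of x) i),
       head = (\<lambda>i. if i < tapes M then head (config_of x) i + shift (snd (w ! i)) else head (config_of x) i) \<rparr>"
      using transition_code by blast
    have "prim_rec (\<lambda>x. if (state (config_of x), scanned M (config_of x)) = (q, a) then g' x else g x)"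
      by (intro prim_rec_if g(1) g'(1) prim_rec_scanned)
    moreover have "config_of (if (state (config_of x), scanned M (config_of x)) = (q, a) then g' x else g x) =
        (if (state (config_of x), scanned M (config_of x)) \<in> insert k D then step M (config_of x) else config_of x)" for x
      using k qa by (auto simp: g(2) g'(2) step_def)
    ultimately show ?case by blast
  qed
  from this[of "dom (delta M)"] assms obtain g where "prim_rec g" "\<And>x. config_of (g x) =
      (if (state (config_of x), scanned M (config_of x)) \<in> dom (delta M) then step M (config_of x) else config_of x)"
    by (auto simp: turing_machine_def)
  moreover have "step M c = c" if "(state c, scanned M c) \<notin> dom (delta M)" for c
    using that by (simp add: step_def domIff del: not_None_eq)
  ultimately show ?thesis by metis
qed

lemma prim_rec_halted:
  assumes "turing_machine M"
  shows "prim_rec_pred (\<lambda>x. halted M (config_of x))"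
proof -
  have "finite D \<Longrightarrow> prim_rec_pred (\<lambda>x. (state (config_of x), scanned M (config_of x)) \<in> D)" for D
  proof (induction rule: finite_induct)
    case (insert k D)
    obtain q a where "k = (q, a)" by fastforce
    with insert.IH have "prim_rec_pred (\<lambda>x. (state (config_of x), scanned M (config_of x)) = k \<or> (state (config_of x), scanned M (config_of x)) \<in> D)"
      by (intro prim_rec_disj) (simp_all only: prim_rec_scanned)
    then show ?case by simp
  qed (simp add: prim_rec_const)
  from prim_rec_not[OF this[of "dom (delta M)"]] assms show ?thesis
    by (simp add: turing_machine_def halted_def domIff del: not_None_eq)
qed

lemma initial_code:
  assumes "\<forall>h\<in>set hs. prim_rec h"
  shows "\<exists>g. prim_rec g \<and> (\<forall>x. config_of (g x) = initial (map (\<lambda>h. h x) hs))"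
proof -
  have "\<exists>g. prim_rec g \<and> (\<forall>x i z. entry (g x) (prod_encode (i, int_encode z)) =
      cells (initial (map (\<lambda>h. h x) hs)) i z)"
    using assms
  proof (induction hs rule: rev_induct)
    case Nil
    show ?case
      by (rule exI[of _ "\<lambda>x. 0"]) (auto simp: initial_def entry_beyond intro: prim_rec_intros)
  next
    case (snoc h hs)
    then obtain g where g: "prim_rec g" "\<And>x i z. entry (g x) (prod_encode (i, int_encode z)) =
      cells (initial (map (\<lambda>h. h x) hs)) i z" by auto
    have h: "prim_rec h" using snoc.prems by simp
    let ?i = "length hs + 1"
    define F where "F x m = rec_nat (g x) (\<lambda>m s. set_entry s (prod_encode (?i, 2 * m)) 1) m" for x m
    have "prim_rec (\<lambda>x. F x (h x))"
      unfolding F_def by (intro g(1) h prim_rec_intros)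
    moreover have "entry (F x m) (prod_encode (i, int_encode z)) =
        (if i = ?i then unary m z else cells (initial (map (\<lambda>h. h x) hs)) i z)" for x m i z
    proof (induction m)
      case 0
      then show ?case by (auto simp: F_def g(2) initial_def unary_def)
    next
      case (Suc m)
      have "2 * m = int_encode (int m)" by (simp add: int_encode_def sum_encode_def)
      then have "int_encode z = 2 * m \<longleftrightarrow> z = int m" by (simp add: int_encode_eq)
      then show ?case using Suc by (auto simp: F_def entry_set_entry unary_def)
    qed
    then have "entry (F x (h x)) (prod_encode (i, int_encode z)) =
        cells (initial (map (\<lambda>h. h x) (hs @ [h]))) i z" for x i z
      by (auto simp: initial_def nth_append)
    ultimately show ?case by blast
  qed
  then obtain g where g: "prim_rec g" "\<And>x i z. entry (g x) (prod_encode (i, int_encode z)) =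
      cells (initial (map (\<lambda>h. h x) hs)) i z" by blast
  have "prim_rec (\<lambda>x. prod_encode (0, prod_encode (0, g x)))" by (intro g(1) prim_rec_intros)
  moreover have "config_of (prod_encode (0, prod_encode (0, g x))) = initial (map (\<lambda>h. h x) hs)" for x
    using g(2) by (auto simp: config_of_def fun_eq_iff initial_def entry_beyond int_decode_def sum_decode_def)
  ultimately show ?thesis by blast
qed

text \<open>
  A function of the number of steps as well as of the input: time-bounded questions about a
  fixed machine are primitive recursive.
\<close>

lemma run_code:
  assumes "turing_machine M" "\<forall>h\<in>set hs. prim_rec h" "prim_rec t"
  shows "\<exists>g. prim_rec g \<and> (\<forall>x. config_of (g x) = run M (map (\<lambda>h. h x) hs) (t x))"
proof -
  obtain s where s: "prim_rec s" "\<And>x. config_of (s x) = step M (config_of x)" using step_code[OF assms(1)] by blast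
  obtain g where g: "prim_rec g" "\<And>x. config_of (g x) = initial (map (\<lambda>h. h x) hs)"
    using initial_code[OF assms(2)] by blast
  have "config_of ((s ^^ n) x) = (step M ^^ n) (config_of x)" for n x
    by (induction n) (auto simp: s(2))
  then have "config_of ((s ^^ t x) (g x)) = run M (map (\<lambda>h. h x) hs) (t x)" for x
    by (simp add: run_def g(2))
  moreover have "prim_rec (\<lambda>x. (s ^^ t x) (g x))"
    by (intro prim_rec_funpow g(1) assms(3) prim_rec.comp[OF s(1)] prim_rec_intros)
  ultimately show ?thesis by blast
qed

text \<open>
  Only cells with an index below the sum of the code of the memory and \<open>2 * y\<close> can differ, since
  both sides vanish from there on.
\<close>

lemma output_code:
  assumes "prim_rec y"
  shows "prim_rec_pred (\<lambda>x. cells (config_of (pfst x)) 0 = unary (y x))"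
proof -
  have "cells (config_of c) 0 = unary n \<longleftrightarrow>
      (\<forall>k<psnd (psnd c) + 2 * n. entry (psnd (psnd c)) (prod_encode (0, k)) = of_bool (even k \<and> k < 2 * n))"
    (is "_ \<longleftrightarrow> ?R") for c n
  proof -
    have "entry (psnd (psnd c)) (prod_encode (0, k)) = of_bool (even k \<and> k < 2 * n)"
      if "\<not> k < psnd (psnd c) + 2 * n" for k
      using that le_prod_encode_2[of k 0] by (simp add: entry_beyond)
    then have "?R \<longleftrightarrow> (\<forall>k. entry (psnd (psnd c)) (prod_encode (0, k)) = of_bool (even k \<and> k < 2 * n))"
      by blast
    also have "\<dots> \<longleftrightarrow> (\<forall>z. entry (psnd (psnd c)) (prod_encode (0, int_encode z)) = unary n z)"
    proof -
      have u: "of_bool (even (int_encode z) \<and> int_encode z < 2 * n) = unary n z" for z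
        by (auto simp: unary_def int_encode_def sum_encode_def)
      show ?thesis unfolding u[symmetric] by (metis int_decode_inverse)
    qed
    finally show ?thesis by (simp add: config_of_def fun_eq_iff)
  qed
  then show ?thesis by (simp only:) (intro prim_rec_intros prim_rec.comp[OF assms])
qed

lemma prim_rec_halted_run [prim_rec_intros]:
  assumes "turing_machine M" "prim_rec a" "prim_rec t"
  shows "prim_rec_pred (\<lambda>x. halted M (run M [a x] (t x)))"
proof -
  obtain g where g: "prim_rec g" "\<And>x. config_of (g x) = run M [a x] (t x)"
    using run_code[OF assms(1), of "[a]" t] assms by auto
  then show ?thesis
    using prim_rec.comp[OF prim_rec_halted[OF assms(1)] g(1)] by simp
qed

lemma prim_rec_run_state [prim_rec_intros]:
  assumes "turing_machine M" "prim_rec a" "prim_rec t" "prim_rec y"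
  shows "prim_rec_pred (\<lambda>x. state (run M [a x] (t x)) = p \<and> cells (run M [a x] (t x)) 0 = unary (y x))"
proof -
  obtain g where g: "prim_rec g" "\<And>x. config_of (g x) = run M [a x] (t x)"
    using run_code[OF assms(1), of "[a]" t] assms by auto
  have "prim_rec_pred (\<lambda>x. pfst (g x) = p \<and> cells (config_of (pfst (prod_encode (g x, y x)))) 0 = unary (psnd (prod_encode (g x, y x))))"
    by (intro prim_rec_intros g(1) prim_rec.comp[OF output_code[OF prim_rec.psnd]] assms)
  moreover have "pfst (g x) = state (run M [a x] (t x))" for x
    by (simp add: g(2)[symmetric]) (simp add: config_of_def)
  ultimately show ?thesis by (simp add: g(2))
qed

lemma prim_rec_run_output [prim_rec_intros]:
  assumes "turing_machine M" "prim_rec a" "prim_rec b" "prim_rec c" "prim_rec t" "prim_rec y"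
  shows "prim_rec_pred (\<lambda>x. halted M (run M [a x, b x, c x] (t x)) \<and>
    cells (run M [a x, b x, c x] (t x)) 0 = unary (y x))"
proof -
  obtain g where g: "prim_rec g" "\<And>x. config_of (g x) = run M [a x, b x, c x] (t x)"
    using run_code[OF assms(1), of "[a, b, c]" t] assms by auto
  have "prim_rec_pred (\<lambda>x. halted M (config_of (g x)) \<and> cells (config_of (pfst (prod_encode (g x, y x)))) 0 = unary (psnd (prod_encode (g x, y x))))"
    by (intro prim_rec_conj prim_rec_pair g(1) prim_rec.comp[OF prim_rec_halted[OF assms(1)] g(1)]
        prim_rec.comp[OF output_code[OF prim_rec.psnd]] assms)
  then show ?thesis by (simp add: g(2))
qed

section \<open>Semidecidable predicates\<close>

text \<open>
  Witnesses instead of halting machines: this makes the closure under conjunction and bounded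
  quantification a matter of combining witnesses.
\<close>

definition semidecidable :: "(nat \<Rightarrow> bool) \<Rightarrow> bool" where
  "semidecidable R \<longleftrightarrow> (\<exists>P. prim_rec_pred P \<and> (\<forall>x. R x \<longleftrightarrow> (\<exists>t. P (prod_encode (x, t)))))"

named_theorems semidecidable_intros

lemma semidecidableI:
  assumes "prim_rec_pred (\<lambda>z. P (pfst z) (psnd z))" "\<And>x. R x \<longleftrightarrow> (\<exists>t. P x t)"
  shows "semidecidable R"
  unfolding semidecidable_def
  by (rule exI[of _ "\<lambda>z. P (pfst z) (psnd z)"]) (use assms in simp)

lemma semidecidableE:
  assumes "semidecidable R"
  obtains P where
    "\<And>f t. prim_rec f \<Longrightarrow> prim_rec t \<Longrightarrow> prim_rec_pred (\<lambda>x. P (f x) (t x))"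
    "\<And>x. R x \<longleftrightarrow> (\<exists>t. P x t)"
proof -
  obtain P where P: "prim_rec_pred P" "\<And>x. R x \<longleftrightarrow> (\<exists>t. P (prod_encode (x, t)))"
    using assms by (auto simp: semidecidable_def)
  show thesis
    by (rule that[of "\<lambda>x t. P (prod_encode (x, t))"])
       (auto simp: P(2) intro!: prim_rec.comp[OF P(1)] prim_rec_intros)
qed

lemma semidecidable_prim_rec:
  assumes "prim_rec_pred P"
  shows "semidecidable P"
  by (rule semidecidableI[of "\<lambda>x t. P x"]) (auto intro: prim_rec.comp[OF assms] prim_rec_intros prim_rec.pfst)

lemma semidecidable_conj [semidecidable_intros]:
  assumes "semidecidable R" "semidecidable Q"
  shows "semidecidable (\<lambda>x. R x \<and> Q x)"
proof -
  obtain P where P: "\<And>f t. prim_rec f \<Longrightarrow> prim_rec t \<Longrightarrow> prim_rec_pred (\<lambda>x. P (f x) (t x))"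
    "\<And>x. R x \<longleftrightarrow> (\<exists>t. P x t)" using assms(1) by (rule semidecidableE) blast
  obtain P' where P': "\<And>f t. prim_rec f \<Longrightarrow> prim_rec t \<Longrightarrow> prim_rec_pred (\<lambda>x. P' (f x) (t x))"
    "\<And>x. Q x \<longleftrightarrow> (\<exists>t. P' x t)" using assms(2) by (rule semidecidableE) blast
  show ?thesis
  proof (rule semidecidableI[of "\<lambda>x t. P x (pfst t) \<and> P' x (psnd t)"])
    show "prim_rec_pred (\<lambda>z. P (pfst z) (pfst (psnd z)) \<and> P' (pfst z) (psnd (psnd z)))"
      by (intro P P' prim_rec_intros)
    show "R x \<and> Q x \<longleftrightarrow> (\<exists>t. P x (pfst t) \<and> P' x (psnd t))" for x
      by (metis P(2) P'(2) pfst_prod_encode psnd_prod_encode)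
  qed
qed

lemma semidecidable_disj [semidecidable_intros]:
  assumes "semidecidable R" "semidecidable Q"
  shows "semidecidable (\<lambda>x. R x \<or> Q x)"
proof -
  obtain P where P: "\<And>f t. prim_rec f \<Longrightarrow> prim_rec t \<Longrightarrow> prim_rec_pred (\<lambda>x. P (f x) (t x))"
    "\<And>x. R x \<longleftrightarrow> (\<exists>t. P x t)" using assms(1) by (rule semidecidableE) blast
  obtain P' where P': "\<And>f t. prim_rec f \<Longrightarrow> prim_rec t \<Longrightarrow> prim_rec_pred (\<lambda>x. P' (f x) (t x))"
    "\<And>x. Q x \<longleftrightarrow> (\<exists>t. P' x t)" using assms(2) by (rule semidecidableE) blast
  show ?thesis
  proof (rule semidecidableI[of "\<lambda>x t. P x t \<or> P' x t"])
    show "prim_rec_pred (\<lambda>z. P (pfst z) (psnd z) \<or> P' (pfst z) (psnd z))"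
      by (intro P P' prim_rec_disj prim_rec.pfst prim_rec.psnd)
  qed (auto simp: P(2) P'(2))
qed

lemma semidecidable_ex [semidecidable_intros]:
  assumes "semidecidable (\<lambda>z. R (pfst z) (psnd z))"
  shows "semidecidable (\<lambda>x. \<exists>y. R x y)"
proof -
  obtain P where P: "\<And>f t. prim_rec f \<Longrightarrow> prim_rec t \<Longrightarrow> prim_rec_pred (\<lambda>x. P (f x) (t x))"
    "\<And>z. R (pfst z) (psnd z) \<longleftrightarrow> (\<exists>t. P z t)" using assms(1) by (rule semidecidableE) blast
  show ?thesis
  proof (rule semidecidableI[of "\<lambda>x t. P (prod_encode (x, pfst t)) (psnd t)"])
    show "prim_rec_pred (\<lambda>z. P (prod_encode (pfst z, pfst (psnd z))) (psnd (psnd z)))"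
      by (intro P prim_rec_intros)
    show "(\<exists>y. R x y) \<longleftrightarrow> (\<exists>t. P (prod_encode (x, pfst t)) (psnd t))" for x
      by (metis P(2) pfst_prod_encode psnd_prod_encode)
  qed
qed

text \<open>
  The witnesses for the finitely many instances are the entries of one sequence.
\<close>

lemma semidecidable_ball [semidecidable_intros]:
  assumes "semidecidable (\<lambda>z. R (pfst z) (psnd z))" "prim_rec b"
  shows "semidecidable (\<lambda>x. \<forall>i<b x. R x i)"
proof -
  obtain P where P: "\<And>f t. prim_rec f \<Longrightarrow> prim_rec t \<Longrightarrow> prim_rec_pred (\<lambda>x. P (f x) (t x))"
    "\<And>z. R (pfst z) (psnd z) \<longleftrightarrow> (\<exists>t. P z t)" using assms(1) by (rule semidecidableE) blast
  have R: "R x i \<longleftrightarrow> (\<exists>t. P (prod_encode (x, i)) t)" for x i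
    using P(2)[of "prod_encode (x, i)"] by simp
  show ?thesis
  proof (rule semidecidableI[of "\<lambda>x t. \<forall>i<b x. P (prod_encode (x, i)) (entry t i)"])
    show "prim_rec_pred (\<lambda>z. \<forall>i<b (pfst z). P (prod_encode (pfst z, i)) (entry (psnd z) i))"
      by (intro prim_rec_ball P prim_rec_intros prim_rec.comp[OF assms(2)])
    show "(\<forall>i<b x. R x i) \<longleftrightarrow> (\<exists>t. \<forall>i<b x. P (prod_encode (x, i)) (entry t i))" for x
    proof
      assume "\<forall>i<b x. R x i"
      then obtain v where v: "\<forall>i<b x. P (prod_encode (x, i)) (v i)" unfolding R by metis
      obtain t where "\<forall>i<b x. entry t i = v i" using exists_entries[of "b x" v] by blast
      with v show "\<exists>t. \<forall>i<b x. P (prod_encode (x, i)) (entry t i)" by (intro exI[of _ t]) auto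
    qed (auto simp: R)
  qed
qed

lemma semidecidable_bex [semidecidable_intros]:
  assumes "semidecidable (\<lambda>z. R (pfst z) (psnd z))" "prim_rec b"
  shows "semidecidable (\<lambda>x. \<exists>i<b x. R x i)"
  by (intro semidecidable_intros assms semidecidable_prim_rec prim_rec_intros prim_rec.comp[OF assms(2)])

lemma semidecidable_halts_on [semidecidable_intros]:
  assumes "turing_machine M" "prim_rec a"
  shows "semidecidable (\<lambda>x. halts_on M [a x])"
  unfolding halts_on_def
  by (intro semidecidable_intros semidecidable_prim_rec prim_rec_intros assms prim_rec.comp[OF assms(2)])

lemma semidecidable_enumerated [semidecidable_intros]:
  assumes "turing_machine M" "prim_rec a" "prim_rec y"
  shows "semidecidable (\<lambda>x. y x \<in> enumerated M p [a x])"
  unfolding enumerated_def mem_Collect_eq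
  by (intro semidecidable_ex semidecidable_prim_rec prim_rec_run_state prim_rec_intros
      assms prim_rec.comp[OF assms(2)] prim_rec.comp[OF assms(3)])

lemma semidecidable_outputs [semidecidable_intros]:
  assumes "turing_machine M" "prim_rec a" "prim_rec b" "prim_rec c" "prim_rec y"
  shows "semidecidable (\<lambda>x. outputs M [a x, b x, c x] (y x))"
  unfolding outputs_def
  by (intro semidecidable_ex semidecidable_prim_rec prim_rec_run_output prim_rec_psnd prim_rec.id
      assms prim_rec.comp[OF assms(2) prim_rec.pfst] prim_rec.comp[OF assms(3) prim_rec.pfst]
      prim_rec.comp[OF assms(4) prim_rec.pfst] prim_rec.comp[OF assms(5) prim_rec.pfst])

section \<open>Certified inclusions of ideal balls\<close>

definition ball_radius :: "nat \<Rightarrow> real" where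
  "ball_radius c = real (pfst (psnd c) + 1) / real (psnd (psnd c) + 1)"

lemma ideal_ball_eq: "ideal_ball s c = ball (s (pfst c)) (ball_radius c)"
  by (simp add: ideal_ball_def ball_radius_def pfst_def psnd_def case_prod_beta)

lemma small_ideal_ball:
  fixes s :: "nat \<Rightarrow> 'a::metric_space"
  assumes "closure (range s) = UNIV" "0 < e"
  shows "\<exists>c. x \<in> ideal_ball s c \<and> ball_radius c < e"
proof -
  obtain b :: nat where b: "1 / real (b + 1) < e"
    using nat_approx_posE[OF assms(2)] by (metis Suc_eq_plus1)
  have "x \<in> closure (range s)" using assms(1) by simp
  then obtain i where "dist (s i) x < 1 / real (b + 1)"
    unfolding closure_approachable by (metis of_nat_0_less_iff rangeE zero_less_divide_1_iff add_gr_0 zero_less_one)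
  with b show ?thesis
    by (intro exI[of _ "prod_encode (i, prod_encode (0, b))"]) (simp add: ideal_ball_eq ball_radius_def)
qed

text \<open>
  Inclusion of balls as sets is in general not semidecidable, but this sufficient condition on
  centres and radii is, and it holds for all sufficiently small balls around a point of an open ball.
\<close>

definition formally_inside :: "(nat \<Rightarrow> 'a::metric_space) \<Rightarrow> nat \<Rightarrow> nat \<Rightarrow> bool" where
  "formally_inside s c v \<longleftrightarrow> dist (s (pfst c)) (s (pfst v)) + ball_radius c < ball_radius v"

lemma formally_inside_subset: "formally_inside s c v \<Longrightarrow> ideal_ball s c \<subseteq> ideal_ball s v"
proof
  fix x assume "formally_inside s c v" "x \<in> ideal_ball s c"
  then show "x \<in> ideal_ball s v"
    using dist_triangle[of "s (pfst v)" x "s (pfst c)"]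
    by (simp add: formally_inside_def ideal_ball_eq dist_commute)
qed

text \<open>
  Numerator and denominator of the absolute value of the rational coded by \<open>u\<close>. The library's
  numbering gives the value \<open>0\<close> to codes with denominator zero, hence the case distinction.
  Passing to absolute values costs nothing for approximations of a distance, since
  \<open>\<bar>\<bar>q\<bar> - d\<bar> \<le> \<bar>q - d\<bar>\<close> for \<open>d \<ge> 0\<close>, and it avoids signed arithmetic.
\<close>

definition rat_num :: "nat \<Rightarrow> nat" where
  "rat_num u = (if psnd u = 0 then 0 else (pfst u + 1) div 2)"

definition rat_den :: "nat \<Rightarrow> nat" where
  "rat_den u = (if psnd u = 0 then 1 else (psnd u + 1) div 2)"

lemma rat_den_pos: "0 < rat_den u"
  by (simp add: rat_den_def)

lemma abs_nat_to_rat_surj: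
  "\<bar>real_of_rat (nat_to_rat_surj u)\<bar> = real (rat_num u) / real (rat_den u)"
proof -
  have "\<bar>int_decode n\<bar> = int ((n + 1) div 2)" for n
  proof (cases "even n")
    case True then show ?thesis by (auto simp: int_decode_def sum_decode_def elim!: evenE)
  next
    case False then show ?thesis by (auto simp: int_decode_def sum_decode_def elim!: oddE)
  qed
  then have abs: "\<bar>real_of_int (int_decode n)\<bar> = real ((n + 1) div 2)" for n
    by (metis of_int_abs of_int_of_nat_eq)
  have "real_of_rat (nat_to_rat_surj u) =
      real_of_int (int_decode (pfst u)) / real_of_int (int_decode (psnd u))"
    by (cases "int_decode (psnd u) = 0")
       (simp_all add: nat_to_rat_surj_def pfst_def psnd_def case_prod_beta of_rat_rat rat_number_collapse)
  then show ?thesis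
    using abs[of "psnd u"] by (simp add: abs_divide abs rat_num_def rat_den_def)
qed

lemma fraction_sum_less:
  fixes A B P a b a' b' :: nat
  assumes "0 < B" "0 < P" "0 < b" "0 < b'"
  shows "real A / real B + 1 / real P + real a / real b < real a' / real b' \<longleftrightarrow>
    (A * P * b + B * b + a * B * P) * b' < a' * (B * P * b)"
proof -
  have "real A / real B + 1 / real P + real a / real b = real (A * P * b + B * b + a * B * P) / real (B * P * b)"
    using assms by (simp add: field_simps)
  also have "\<dots> < real a' / real b' \<longleftrightarrow>
      real (A * P * b + B * b + a * B * P) * real b' < real a' * real (B * P * b)"
    using assms by (subst frac_less_eq) (auto simp: divide_less_0_iff mult_less_0_iff)
  also have "\<dots> \<longleftrightarrow> (A * P * b + B * b + a * B * P) * b' < a' * (B * P * b)"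
    by (simp only: of_nat_mult[symmetric] of_nat_less_iff)
  finally show ?thesis .
qed

text \<open>
  The strict inequality holds iff it holds for the upper bound \<open>\<bar>q\<bar> + 1 / 2 ^ n\<close> of the
  distance, where \<open>q\<close> is the computed approximation for some precision \<open>n\<close>: the bound exceeds
  the distance by at most \<open>2 / 2 ^ n\<close>. The output of a machine is unique, so any witnessed
  output obeys the promised error bound.
\<close>

lemma semidecidable_formally_inside [semidecidable_intros]:
  fixes s :: "nat \<Rightarrow> 'a::metric_space"
  assumes "computable_metric_space s" "prim_rec c" "prim_rec v"
  shows "semidecidable (\<lambda>x. formally_inside s (c x) (v x))"
proof -
  obtain M where M: "turing_machine M" and out: "\<And>i j n. \<exists>u. outputs M [i, j, n] u \<and>
      \<bar>dist (s i) (s j) - real_of_rat (nat_to_rat_surj u)\<bar> \<le> 1 / 2 ^ n"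
    using assms(1) by (auto simp: computable_metric_space_def)
  have unique: "u = u'" if outs: "outputs M xs u" "outputs M xs u'" for xs u u'
  proof -
    have *: "run M xs t' = run M xs t" if "halted M (run M xs t)" "t \<le> t'" for t t'
      using that(2)
    proof (induction rule: dec_induct)
      case (step m)
      have "step M (run M xs t) = run M xs t"
        using that(1) by (simp add: halted_def step_def)
      then show ?case using step.IH by (simp add: run_def)
    qed simp
    obtain t t' where t: "halted M (run M xs t)" "cells (run M xs t) 0 = unary u"
      and t': "halted M (run M xs t')" "cells (run M xs t') 0 = unary u'"
      using outs by (auto simp: outputs_def)
    have "run M xs t = run M xs t'"
      using *[OF t(1), of t'] *[OF t'(1), of t] by (cases "t \<le> t'") auto
    then have "unary u = unary u'" using t(2) t'(2) by simp
    then have "unary u (int u) = unary u' (int u)" "unary u (int u') = unary u' (int u')" by simp_all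
    then show ?thesis by (auto simp: unary_def split: if_splits)
  qed
  define less where "less c v n u \<longleftrightarrow>
    (rat_num u * 2 ^ n * (psnd (psnd c) + 1) + rat_den u * (psnd (psnd c) + 1) +
      (pfst (psnd c) + 1) * rat_den u * 2 ^ n) * (psnd (psnd v) + 1)
    < (pfst (psnd v) + 1) * (rat_den u * 2 ^ n * (psnd (psnd c) + 1))" for c v n u
  have less: "less c v n u \<longleftrightarrow>
      \<bar>real_of_rat (nat_to_rat_surj u)\<bar> + 1 / 2 ^ n + ball_radius c < ball_radius v" for c v n u
    using fraction_sum_less[of "rat_den u" "2 ^ n" "psnd (psnd c) + 1" "psnd (psnd v) + 1"
        "rat_num u" "pfst (psnd c) + 1" "pfst (psnd v) + 1"] rat_den_pos
    unfolding less_def ball_radius_def abs_nat_to_rat_surj by simp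
  have "formally_inside s c v \<longleftrightarrow> (\<exists>n u. outputs M [pfst c, pfst v, n] u \<and> less c v n u)" for c v
  proof
    assume "formally_inside s c v"
    then have gap: "0 < (ball_radius v - ball_radius c - dist (s (pfst c)) (s (pfst v))) / 2"
      by (simp add: formally_inside_def)
    obtain n where n: "(1 / 2) ^ n < (ball_radius v - ball_radius c - dist (s (pfst c)) (s (pfst v))) / 2"
      using real_arch_pow_inv[OF gap, of "1/2"] by auto
    obtain u where u: "outputs M [pfst c, pfst v, n] u"
      "\<bar>dist (s (pfst c)) (s (pfst v)) - real_of_rat (nat_to_rat_surj u)\<bar> \<le> 1 / 2 ^ n"
      using out by blast
    have "\<bar>real_of_rat (nat_to_rat_surj u)\<bar> \<le> dist (s (pfst c)) (s (pfst v)) + 1 / 2 ^ n"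
      using u(2) zero_le_dist[of "s (pfst c)" "s (pfst v)"] by linarith
    then have "less c v n u" using n unfolding less by (simp add: power_divide)
    with u(1) show "\<exists>n u. outputs M [pfst c, pfst v, n] u \<and> less c v n u" by blast
  next
    assume "\<exists>n u. outputs M [pfst c, pfst v, n] u \<and> less c v n u"
    then obtain n u where u: "outputs M [pfst c, pfst v, n] u" "less c v n u" by blast
    then have "\<bar>dist (s (pfst c)) (s (pfst v)) - real_of_rat (nat_to_rat_surj u)\<bar> \<le> 1 / 2 ^ n"
      using out[of "pfst c" "pfst v" n] unique by blast
    with u(2) show "formally_inside s c v"
      unfolding less formally_inside_def by linarith
  qed
  moreover have "semidecidable (\<lambda>x. \<exists>n u. outputs M [pfst (c x), pfst (v x), n] u \<and> less (c x) (v x) n u)"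
    unfolding less_def rat_num_def rat_den_def
    by (intro semidecidable_ex semidecidable_conj semidecidable_outputs semidecidable_prim_rec
        prim_rec_intros M prim_rec.comp[OF assms(2)] prim_rec.comp[OF assms(3)])
  ultimately show ?thesis by simp
qed

text \<open>
  A certificate for \<open>(f ^^ j) ` ideal_ball s c \<subseteq> ideal_ball s d\<close>: a chain of balls, the first
  one around \<open>c\<close>, the last one equal to \<open>d\<close>, in which each ball is listed by the machine for \<open>f\<close>
  as part of the preimage of the next one.
\<close>

definition sub_preimage :: "(nat \<Rightarrow> 'a::metric_space) \<Rightarrow> tm \<Rightarrow> nat \<Rightarrow> nat \<Rightarrow> nat \<Rightarrow> nat \<Rightarrow> bool" where
  "sub_preimage s M p c j d \<longleftrightarrow> (\<exists>v. formally_inside s c (entry v 0) \<and> entry v j = d \<and>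
     (\<forall>l<j. entry v l \<in> enumerated M p [entry v (Suc l)]))"

lemma semidecidable_sub_preimage [semidecidable_intros]:
  assumes "computable_metric_space s" "turing_machine M" "prim_rec c" "prim_rec j" "prim_rec d"
  shows "semidecidable (\<lambda>x. sub_preimage s M p (c x) (j x) (d x))"
  unfolding sub_preimage_def
  by (intro semidecidable_ex semidecidable_conj semidecidable_ball semidecidable_enumerated
      semidecidable_formally_inside semidecidable_prim_rec
      prim_rec_intros assms prim_rec.comp[OF assms(3)] prim_rec.comp[OF assms(4)] prim_rec.comp[OF assms(5)])

lemma sub_preimage_sound:
  assumes f: "\<And>m. f -` ideal_ball s m = ball_union s (enumerated M p [m])"
    and "sub_preimage s M p c j d" "x \<in> ideal_ball s c"
  shows "(f ^^ j) x \<in> ideal_ball s d"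
proof -
  obtain v where v: "formally_inside s c (entry v 0)" "entry v j = d"
    "\<forall>l<j. entry v l \<in> enumerated M p [entry v (Suc l)]"
    using assms(2) by (auto simp: sub_preimage_def)
  have "l \<le> j \<Longrightarrow> (f ^^ l) x \<in> ideal_ball s (entry v l)" for l
  proof (induction l)
    case 0
    then show ?case using formally_inside_subset[OF v(1)] assms(3) by auto
  next
    case (Suc l)
    then have "(f ^^ l) x \<in> ball_union s (enumerated M p [entry v (Suc l)])"
      using v(3) by (auto simp: ball_union_def)
    then show ?case by (simp add: f[symmetric])
  qed
  with v(2) show ?thesis by blast
qed

text \<open>
  The chain is found by pulling back from \<open>d\<close>: at each step the machine lists a ball around the
  current point of the orbit. It starts with a ball \<open>e\<close> around \<open>x\<close>, and then serves every \<open>c\<close>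
  that is formally inside \<open>e\<close>; this freedom allows one \<open>c\<close> to be chosen for several \<open>j\<close> at once.
\<close>

lemma sub_preimage_complete:
  assumes f: "\<And>m. f -` ideal_ball s m = ball_union s (enumerated M p [m])"
    and "(f ^^ j) x \<in> ideal_ball s d"
  shows "\<exists>e. x \<in> ideal_ball s e \<and> (\<forall>c. formally_inside s c e \<longrightarrow> sub_preimage s M p c j d)"
proof -
  have "\<exists>v. x \<in> ideal_ball s (entry v 0) \<and> entry v j = d \<and>
     (\<forall>l<j. entry v l \<in> enumerated M p [entry v (Suc l)])"
    using assms(2)
  proof (induction j arbitrary: d)
    case 0
    obtain v where "entry v 0 = d" using exists_entries[of 1 "\<lambda>_. d"] by auto
    with 0 show ?case by auto
  next
    case (Suc j)
    then have "(f ^^ j) x \<in> f -` ideal_ball s d" by simp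
    then obtain d' where d': "d' \<in> enumerated M p [d]" "(f ^^ j) x \<in> ideal_ball s d'"
      unfolding f by (auto simp: ball_union_def)
    from Suc.IH[OF d'(2)] obtain v where v: "x \<in> ideal_ball s (entry v 0)" "entry v j = d'"
     "\<forall>l<j. entry v l \<in> enumerated M p [entry v (Suc l)]" by blast
    show ?case
      by (rule exI[of _ "set_entry v (Suc j) d"]) (use v d' in \<open>auto simp: entry_set_entry less_Suc_eq\<close>)
  qed
  then show ?thesis unfolding sub_preimage_def by blast
qed

section \<open>Covers by words of balls\<close>

definition word_cover :: "(nat \<Rightarrow> 'a::metric_space) \<Rightarrow> 'a set \<Rightarrow> ('a \<Rightarrow> 'a) \<Rightarrow> nat set \<Rightarrow> nat \<Rightarrow> nat \<Rightarrow> bool" where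
  "word_cover s K f C N n \<longleftrightarrow> (\<exists>W. (\<forall>w<N. \<forall>j<n. W w j \<in> C) \<and>
     (\<forall>x\<in>K. \<exists>w<N. \<forall>j<n. (f ^^ j) x \<in> ideal_ball s (W w j)))"

lemma word_coverE:
  assumes "word_cover s K f C N n"
  obtains W where "\<And>w j. w < N \<Longrightarrow> j < n \<Longrightarrow> W w j \<in> C"
    "\<And>x. x \<in> K \<Longrightarrow> \<exists>w<N. \<forall>j<n. (f ^^ j) x \<in> ideal_ball s (W w j)"
proof -
  obtain W where "\<forall>w<N. \<forall>j<n. W w j \<in> C"
    "\<forall>x\<in>K. \<exists>w<N. \<forall>j<n. (f ^^ j) x \<in> ideal_ball s (W w j)"
    using assms unfolding word_cover_def by (elim exE conjE)
  then show thesis by (intro that[of W]) simp_all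
qed

definition small_balls :: "nat \<Rightarrow> nat set" where
  "small_balls k = {c. ball_radius c < 1 / real (k + 1)}"

text \<open>
  A cover has a finite certificate: a number \<open>W\<close> coding the words and a set \<open>E\<close> of balls that
  cover the space, each of which misses \<open>K\<close> or is certified to follow one of the words. To find
  \<open>E\<close>, every point is put into a ball of this kind and compactness is applied. A point of \<open>K\<close>
  that follows the word \<open>w\<close> has for each \<open>j < n\<close> a ball with a certificate for the \<open>j\<close>-th
  letter, and a ball around the point that is small compared with all the distances to their
  boundaries is certified for all letters.
\<close>

lemma word_cover_certificate:
  fixes s :: "nat \<Rightarrow> 'a::metric_space"
  assumes dense: "closure (range s) = UNIV" and "compact (UNIV :: 'a set)"
    and MX: "\<And>e. halts_on MX [e] \<longleftrightarrow> UNIV \<subseteq> ball_union s (set_decode e)"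
    and MK: "UNIV - K = ball_union s {n. halts_on MK [n]}"
    and f: "\<And>m. f -` ideal_ball s m = ball_union s (enumerated M p [m])"
  shows "word_cover s K f C N n \<longleftrightarrow> (\<exists>W E.
    (\<forall>w<N. \<forall>j<n. entry W (prod_encode (w, j)) \<in> C) \<and> halts_on MX [E] \<and>
    (\<forall>c<E. c \<notin> set_decode E \<or> halts_on MK [c] \<or>
      (\<exists>w<N. \<forall>j<n. sub_preimage s M p c j (entry W (prod_encode (w, j))))))"
  (is "_ \<longleftrightarrow> (\<exists>W E. ?cert W E)")
proof
  assume "word_cover s K f C N n"
  then obtain W where W: "\<forall>w<N. \<forall>j<n. W w j \<in> C"
    and cov: "\<forall>x\<in>K. \<exists>w<N. \<forall>j<n. (f ^^ j) x \<in> ideal_ball s (W w j)"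
    by (auto simp: word_cover_def)
  have "finite (prod_encode ` ({..<N} \<times> {..<n}))" by simp
  then obtain B where B: "prod_encode ` ({..<N} \<times> {..<n}) \<subseteq> {..<B}"
    by (auto simp: finite_nat_iff_bounded)
  obtain V where "\<forall>i<B. entry V i = (case prod_decode i of (w, j) \<Rightarrow> W w j)"
    using exists_entries[of B "\<lambda>i. case prod_decode i of (w, j) \<Rightarrow> W w j"] by blast
  then have V: "entry V (prod_encode (w, j)) = W w j" if "w < N" "j < n" for w j
    using that B by (auto simp: image_subset_iff)
  define G where "G = {c. halts_on MK [c] \<or> (\<exists>w<N. \<forall>j<n. sub_preimage s M p c j (W w j))}"
  have "\<exists>c\<in>G. x \<in> ideal_ball s c" for x
  proof (cases "x \<in> K")
    case False
    then have "x \<in> ball_union s {n. halts_on MK [n]}" using MK by blast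
    then show ?thesis by (auto simp: ball_union_def G_def)
  next
    case True
    then obtain w where w: "w < N" "\<forall>j<n. (f ^^ j) x \<in> ideal_ball s (W w j)" using cov by blast
    then have "\<forall>j<n. \<exists>e. x \<in> ideal_ball s e \<and> (\<forall>c. formally_inside s c e \<longrightarrow> sub_preimage s M p c j (W w j))"
      using sub_preimage_complete[OF f] by blast
    then obtain e where e: "\<And>j. j < n \<Longrightarrow> x \<in> ideal_ball s (e j)"
      "\<And>j c. j < n \<Longrightarrow> formally_inside s c (e j) \<Longrightarrow> sub_preimage s M p c j (W w j)" by metis
    \<comment> \<open>The \<open>1\<close> is for \<open>n = 0\<close>, when no letter restricts the ball.\<close>
    define \<delta> where "\<delta> = Min (insert 1 ((\<lambda>j. ball_radius (e j) - dist (s (pfst (e j))) x) ` {..<n}))"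
    have "0 < \<delta>" using e(1) by (auto simp: \<delta>_def ideal_ball_eq)
    have \<delta>: "\<delta> \<le> ball_radius (e j) - dist (s (pfst (e j))) x" if "j < n" for j
      using that by (auto simp: \<delta>_def)
    obtain c where c: "x \<in> ideal_ball s c" "ball_radius c < \<delta> / 2"
      using small_ideal_ball[OF dense, of "\<delta> / 2"] \<open>0 < \<delta>\<close> by auto
    have "formally_inside s c (e j)" if "j < n" for j
      using \<delta>[OF that] c dist_triangle[of "s (pfst c)" "s (pfst (e j))" x]
      by (simp add: formally_inside_def ideal_ball_eq dist_commute)
    then show ?thesis using e(2) w(1) c(1) unfolding G_def by blast
  qed
  then have "UNIV \<subseteq> (\<Union>c\<in>G. ideal_ball s c)" by auto
  then obtain G' where G': "G' \<subseteq> G" "finite G'" "UNIV \<subseteq> (\<Union>c\<in>G'. ideal_ball s c)"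
    by (rule compactE_image[OF \<open>compact UNIV\<close>, rotated]) (auto simp: ideal_ball_eq)
  have "halts_on MK [c] \<or> (\<exists>w<N. \<forall>j<n. sub_preimage s M p c j (entry V (prod_encode (w, j))))"
    if "c \<in> G'" for c
  proof -
    have "halts_on MK [c] \<or> (\<exists>w<N. \<forall>j<n. sub_preimage s M p c j (W w j))"
      using that G'(1) by (auto simp: G_def)
    then show ?thesis using V by (elim disjE exE conjE) auto
  qed
  then have "?cert V (set_encode G')"
    using W V G'(2,3) by (auto simp: MX ball_union_def)
  then show "\<exists>W E. ?cert W E" by blast
next
  assume "\<exists>W E. ?cert W E"
  then obtain W E where W: "\<forall>w<N. \<forall>j<n. entry W (prod_encode (w, j)) \<in> C" and E: "halts_on MX [E]"
    "\<And>c. c < E \<Longrightarrow> c \<in> set_decode E \<Longrightarrow> \<not> halts_on MK [c] \<Longrightarrow>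
      \<exists>w<N. \<forall>j<n. sub_preimage s M p c j (entry W (prod_encode (w, j)))" by blast
  have bound: "c < E" if "c \<in> set_decode E" for c
  proof -
    have "2 ^ c \<le> E"
      using that by (intro leI notI) (simp add: set_decode_def)
    then show ?thesis using less_exp[of c] by linarith
  qed
  have "\<exists>w<N. \<forall>j<n. (f ^^ j) x \<in> ideal_ball s (entry W (prod_encode (w, j)))" if x: "x \<in> K" for x
  proof -
    obtain c where c: "c \<in> set_decode E" "x \<in> ideal_ball s c"
      using E(1) by (auto simp: MX ball_union_def)
    have "\<not> halts_on MK [c]"
    proof
      assume "halts_on MK [c]"
      then have "x \<in> UNIV - K" using c(2) unfolding MK by (auto simp: ball_union_def)
      with x show False by simp
    qed
    with E(2)[OF bound[OF c(1)] c(1)] obtain w where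
      "w < N" "\<forall>j<n. sub_preimage s M p c j (entry W (prod_encode (w, j)))" by blast
    then show ?thesis using sub_preimage_sound[OF f] c(2) by blast
  qed
  with W show "word_cover s K f C N n"
    unfolding word_cover_def by (intro exI[of _ "\<lambda>w j. entry W (prod_encode (w, j))"]) blast
qed

lemma semidecidable_word_cover:
  fixes s :: "nat \<Rightarrow> 'a::metric_space"
  assumes "computable_metric_space s" "recursively_compact s" "computable_map s f" "effective_closed s K"
    and C: "prim_rec_pred (\<lambda>z. psnd z \<in> C (pfst z))" and "prim_rec k" "prim_rec N" "prim_rec n"
  shows "semidecidable (\<lambda>x. word_cover s K f (C (k x)) (N x) (n x))"
proof -
  have dense: "closure (range s) = UNIV"
    using assms(1) by (simp add: computable_metric_space_def)
  obtain MX where MX: "turing_machine MX" "\<And>e. halts_on MX [e] \<longleftrightarrow> UNIV \<subseteq> ball_union s (set_decode e)"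
    and comp: "compact (UNIV :: 'a set)"
    using assms(2) by (auto simp: recursively_compact_def)
  obtain M p where M: "turing_machine M" "\<And>m. f -` ideal_ball s m = ball_union s (enumerated M p [m])"
    using assms(3) by (auto simp: computable_map_def)
  obtain MK where MK: "turing_machine MK" "UNIV - K = ball_union s {n. halts_on MK [n]}"
    using assms(4) by (auto simp: effective_closed_def)
  note sub = prim_rec.comp[OF assms(6)] prim_rec.comp[OF assms(7)] prim_rec.comp[OF assms(8)]
  have C': "prim_rec_pred (\<lambda>x. g x \<in> C (h x))" if "prim_rec g" "prim_rec h" for g h
    using prim_rec.comp[OF C prim_rec_pair[OF that(2,1)]] by simp
  show ?thesis
    unfolding word_cover_certificate[OF dense comp MX(2) MK(2) M(2)]
    by (intro semidecidable_ex semidecidable_conj semidecidable_ball semidecidable_disj semidecidable_bex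
        semidecidable_halts_on semidecidable_sub_preimage semidecidable_prim_rec C' MX(1) MK(1) M(1) assms(1)
        prim_rec_not prim_rec_set_decode prim_rec_pair prim_rec_entry prim_rec_pfst prim_rec_psnd prim_rec_id sub)
qed

lemma prim_rec_small_balls: "prim_rec_pred (\<lambda>z. psnd z \<in> small_balls (pfst z))"
proof -
  have "c \<in> small_balls k \<longleftrightarrow> (pfst (psnd c) + 1) * (k + 1) < psnd (psnd c) + 1" for c k
  proof -
    have "c \<in> small_balls k \<longleftrightarrow> real ((pfst (psnd c) + 1) * (k + 1)) < real (psnd (psnd c) + 1)"
      by (simp add: small_balls_def ball_radius_def field_simps)
    then show ?thesis by (simp only: of_nat_less_iff)
  qed
  then show ?thesis by (simp only:) (intro prim_rec_intros)
qed

section \<open>Entropy as a supremum over scales\<close>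

lemma funpow_preimage_cover: "(preimage_cover f ^^ n) \<U> = (\<lambda>U. (f ^^ n) -` U) ` \<U>"
proof (induction n)
  case (Suc n)
  then show ?case
    by (auto simp: preimage_cover_def image_image funpow_swap1 vimage_def)
qed simp

text \<open>
  The elements of the iterated join are the sets described by words over the cover.
\<close>

lemma mem_iterated_join:
  "A \<in> iterated_join f \<U> n \<longleftrightarrow> (\<exists>u. (\<forall>j<n. u j \<in> \<U>) \<and> A = {x. \<forall>j<n. (f ^^ j) x \<in> u j})"
proof (induction n arbitrary: A)
  case 0
  then show ?case by auto
next
  case (Suc n)
  show ?case
  proof
    assume "A \<in> iterated_join f \<U> (Suc n)"
    then obtain u U where "\<forall>j<n. u j \<in> \<U>" "U \<in> \<U>" "A = {x. \<forall>j<n. (f ^^ j) x \<in> u j} \<inter> (f ^^ n) -` U"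
      by (auto simp: join_def funpow_preimage_cover Suc)
    then show "\<exists>u. (\<forall>j<Suc n. u j \<in> \<U>) \<and> A = {x. \<forall>j<Suc n. (f ^^ j) x \<in> u j}"
      by (intro exI[of _ "u(n := U)"]) (auto simp: less_Suc_eq)
  next
    assume "\<exists>u. (\<forall>j<Suc n. u j \<in> \<U>) \<and> A = {x. \<forall>j<Suc n. (f ^^ j) x \<in> u j}"
    then obtain u where u: "\<forall>j<Suc n. u j \<in> \<U>" "A = {x. \<forall>j<Suc n. (f ^^ j) x \<in> u j}" by blast
    then have "A = {x. \<forall>j<n. (f ^^ j) x \<in> u j} \<inter> (f ^^ n) -` u n" by (auto simp: less_Suc_eq)
    moreover have "{x. \<forall>j<n. (f ^^ j) x \<in> u j} \<in> iterated_join f \<U> n"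
      unfolding Suc using u(1) by (intro exI[of _ u]) auto
    ultimately show "A \<in> iterated_join f \<U> (Suc n)"
      unfolding iterated_join.simps join_def funpow_preimage_cover mem_Collect_eq
      using u(1) by (intro exI[of _ "{x. \<forall>j<n. (f ^^ j) x \<in> u j}"] exI[of _ "(f ^^ n) -` u n"]) auto
  qed
qed

lemma finite_iterated_join: "finite \<U> \<Longrightarrow> finite (iterated_join f \<U> n)"
proof (induction n)
  case (Suc n)
  have "iterated_join f \<U> (Suc n) =
      (\<lambda>(U, V). U \<inter> V) ` (iterated_join f \<U> n \<times> (preimage_cover f ^^ n) \<U>)"
    by (auto simp: join_def)
  then show ?case using Suc by (simp add: funpow_preimage_cover)
qed simp

lemma funpow_invariant: "f ` K \<subseteq> K \<Longrightarrow> x \<in> K \<Longrightarrow> (f ^^ j) x \<in> K"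
  by (induction j) auto

lemma cover_number_attained:
  assumes "finite \<U>" "K \<subseteq> \<Union>\<U>" "f ` K \<subseteq> K"
  shows "\<exists>\<V>\<subseteq>iterated_join f \<U> n. K \<subseteq> \<Union>\<V> \<and> finite \<V> \<and> card \<V> = cover_number K f \<U> n"
proof -
  have "K \<subseteq> \<Union>(iterated_join f \<U> n)"
  proof
    fix x assume "x \<in> K"
    then have "\<forall>j. \<exists>U\<in>\<U>. (f ^^ j) x \<in> U" using funpow_invariant[OF assms(3)] assms(2) by blast
    then obtain u where "\<forall>j. u j \<in> \<U> \<and> (f ^^ j) x \<in> u j" by metis
    then show "x \<in> \<Union>(iterated_join f \<U> n)"
      by (intro UnionI[of "{x. \<forall>j<n. (f ^^ j) x \<in> u j}"]) (auto simp: mem_iterated_join)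
  qed
  then have "\<exists>m. \<exists>\<V>\<subseteq>iterated_join f \<U> n. K \<subseteq> \<Union>\<V> \<and> finite \<V> \<and> card \<V> = m"
    using finite_iterated_join[OF assms(1)] by blast
  then have "\<exists>\<V>\<subseteq>iterated_join f \<U> n. K \<subseteq> \<Union>\<V> \<and> finite \<V> \<and>
      card \<V> = (LEAST m. \<exists>\<V>\<subseteq>iterated_join f \<U> n. K \<subseteq> \<Union>\<V> \<and> finite \<V> \<and> card \<V> = m)"
    by (rule LeastI_ex)
  then show ?thesis unfolding cover_number_def .
qed

text \<open>
  If a point of \<open>K\<close> follows a word of small balls, then each of these balls lies within the
  Lebesgue number of the orbit of the point, hence in an element of the cover. So the set
  described by the word is contained in an element of the iterated join, and the words yield a
  sub-cover. Words that no point of \<open>K\<close> follows are dropped.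
\<close>

lemma cover_entropy_le_word_cover:
  fixes K :: "'a::metric_space set"
  assumes \<delta>: "\<And>x. x \<in> K \<Longrightarrow> \<exists>U\<in>\<U>. ball x \<delta> \<subseteq> U" and k: "2 / real (k + 1) \<le> \<delta>"
    and K: "f ` K \<subseteq> K" and n: "1 \<le> n" and "word_cover s K f (small_balls k) (2 ^ a) n"
  shows "cover_entropy K f \<U> \<le> ereal (real a / real n)"
proof -
  obtain W where W: "\<And>w j. w < (2::nat) ^ a \<Longrightarrow> j < n \<Longrightarrow> W w j \<in> small_balls k"
    and cov: "\<And>x. x \<in> K \<Longrightarrow> \<exists>w<(2::nat) ^ a. \<forall>j<n. (f ^^ j) x \<in> ideal_ball s (W w j)"
    using assms(5) by (rule word_coverE) blast
  define cell where "cell w = {x. \<forall>j<n. (f ^^ j) x \<in> ideal_ball s (W w j)}" for w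
  define I where "I = {w. w < 2 ^ a \<and> cell w \<inter> K \<noteq> {}}"
  have "\<exists>A\<in>iterated_join f \<U> n. cell w \<subseteq> A" if "w \<in> I" for w
  proof -
    obtain x where x: "x \<in> K" "x \<in> cell w" and w: "w < 2 ^ a" using \<open>w \<in> I\<close> by (auto simp: I_def)
    have "\<forall>j. \<exists>U\<in>\<U>. ball ((f ^^ j) x) \<delta> \<subseteq> U"
      using \<delta> funpow_invariant[OF K x(1)] by blast
    then obtain u where u: "\<And>j. u j \<in> \<U>" "\<And>j. ball ((f ^^ j) x) \<delta> \<subseteq> u j" by metis
    have "(f ^^ j) y \<in> u j" if "y \<in> cell w" "j < n" for y j
    proof -
      let ?c = "s (pfst (W w j))"
      have "dist ?c ((f ^^ j) x) < 1 / real (k + 1)" "dist ?c ((f ^^ j) y) < 1 / real (k + 1)"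
        using x(2) that W[OF w that(2)] by (auto simp: cell_def ideal_ball_eq small_balls_def intro: less_trans)
      then have "dist ((f ^^ j) x) ((f ^^ j) y) < 2 / real (k + 1)"
        using dist_triangle3[of "(f ^^ j) x" "(f ^^ j) y" ?c] by simp
      then show ?thesis using k u(2)[of j] by (auto simp: subset_iff)
    qed
    then show ?thesis
      by (intro bexI[of _ "{x. \<forall>j<n. (f ^^ j) x \<in> u j}"])
         (use u(1) in \<open>auto simp: mem_iterated_join intro!: exI[of _ u]\<close>)
  qed
  then obtain A where A: "\<And>w. w \<in> I \<Longrightarrow> A w \<in> iterated_join f \<U> n" "\<And>w. w \<in> I \<Longrightarrow> cell w \<subseteq> A w"
    by metis
  have "I \<subseteq> {..<2 ^ a}" by (auto simp: I_def)
  then have "finite I" "card I \<le> 2 ^ a"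
    using finite_subset card_mono[of "{..<2 ^ a::nat}" I] by auto
  have "K \<subseteq> \<Union>(A ` I)"
  proof
    fix x assume "x \<in> K"
    with cov obtain w where "w < 2 ^ a" "x \<in> cell w" by (auto simp: cell_def)
    with \<open>x \<in> K\<close> have "w \<in> I" by (auto simp: I_def)
    then show "x \<in> \<Union>(A ` I)" using A(2) \<open>x \<in> cell w\<close> by blast
  qed
  then have "cover_number K f \<U> n \<le> card (A ` I)"
    unfolding cover_number_def using A(1) \<open>finite I\<close>
    by (intro Least_le exI[of _ "A ` I"]) auto
  also have "\<dots> \<le> 2 ^ a"
    using card_image_le[OF \<open>finite I\<close>, of A] \<open>card I \<le> 2 ^ a\<close> by linarith
  finally have N: "cover_number K f \<U> n \<le> 2 ^ a" .
  have "log 2 (real (cover_number K f \<U> n)) \<le> real a"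
  proof (cases "cover_number K f \<U> n = 0")
    case True
    then show ?thesis by (simp add: log_def)
  next
    case False
    have "log 2 (real (cover_number K f \<U> n)) \<le> log 2 (2 ^ a)"
      using N False by (subst log_le_cancel_iff) (auto simp flip: of_nat_power_le_of_nat_cancel_iff of_nat_le_iff)
    then show ?thesis by simp
  qed
  then have "log 2 (real (cover_number K f \<U> n)) / real n \<le> real a / real n"
    by (rule divide_right_mono) simp
  then show ?thesis
    unfolding cover_entropy_def using n by (intro INF_lower2[of n]) auto
qed

text \<open>
  A point follows a word for the first \<open>n\<close> steps, and its \<open>n\<close>-th iterate, again in \<open>K\<close>, follows
  a word for the next \<open>n'\<close> steps. The pairs of words are numbered by quotient and remainder.
\<close>

lemma word_cover_concat:
  assumes "f ` K \<subseteq> K" "word_cover s K f C N n" "word_cover s K f C N' n'"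
  shows "word_cover s K f C (N * N') (n + n')"
proof -
  obtain W where W: "\<And>w j. w < N \<Longrightarrow> j < n \<Longrightarrow> W w j \<in> C"
    "\<And>x. x \<in> K \<Longrightarrow> \<exists>w<N. \<forall>j<n. (f ^^ j) x \<in> ideal_ball s (W w j)"
    using assms(2) by (rule word_coverE) blast
  obtain W' where W': "\<And>w j. w < N' \<Longrightarrow> j < n' \<Longrightarrow> W' w j \<in> C"
    "\<And>x. x \<in> K \<Longrightarrow> \<exists>w<N'. \<forall>j<n'. (f ^^ j) x \<in> ideal_ball s (W' w j)"
    using assms(3) by (rule word_coverE) blast
  define V where "V w j = (if j < n then W (w div N') j else W' (w mod N') (j - n))" for w j
  have "V w j \<in> C" if "w < N * N'" "j < n + n'" for w j
  proof -
    have "0 < N'" using that(1) by (cases N') auto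
    then show ?thesis using that W(1) W'(1) by (auto simp: V_def less_mult_imp_div_less)
  qed
  moreover have "\<exists>w<N * N'. \<forall>j<n + n'. (f ^^ j) x \<in> ideal_ball s (V w j)" if x: "x \<in> K" for x
  proof -
    obtain w where w: "w < N" "\<forall>j<n. (f ^^ j) x \<in> ideal_ball s (W w j)" using W(2)[OF x] by blast
    obtain w' where w': "w' < N'" "\<forall>j<n'. (f ^^ j) ((f ^^ n) x) \<in> ideal_ball s (W' w' j)"
      using W'(2)[OF funpow_invariant[OF assms(1) x]] by blast
    have "w * N' + w' < Suc w * N'" using w'(1) by simp
    also have "\<dots> \<le> N * N'" using w(1) by (intro mult_le_mono1) simp
    finally have "w * N' + w' < N * N'" .
    moreover have "(f ^^ j) x \<in> ideal_ball s (V (w * N' + w') j)" if "j < n + n'" for j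
    proof (cases "j < n")
      case True
      then show ?thesis using w w' by (simp add: V_def)
    next
      case False
      then have "(f ^^ (j - n)) ((f ^^ n) x) \<in> ideal_ball s (W' w' (j - n))" using w' that by auto
      moreover have "(f ^^ (j - n)) ((f ^^ n) x) = (f ^^ j) x"
        using False by (metis comp_apply funpow_add le_add_diff_inverse2 linorder_not_less)
      ultimately show ?thesis using False w' by (simp add: V_def)
    qed
    ultimately show ?thesis by blast
  qed
  ultimately show ?thesis unfolding word_cover_def by blast
qed

lemma word_cover_power:
  assumes "f ` K \<subseteq> K" "word_cover s K f C N n"
  shows "word_cover s K f C (N ^ l) (l * n)"
proof (induction l)
  case 0
  show ?case by (simp add: word_cover_def)
next
  case (Suc l)
  from word_cover_concat[OF assms this] show ?case by simp
qed

lemma word_cover_mono: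
  assumes "word_cover s K f C N n" "C \<subseteq> C'" "0 < N" "N \<le> N'"
  shows "word_cover s K f C' N' n"
proof -
  obtain W where W: "\<And>w j. w < N \<Longrightarrow> j < n \<Longrightarrow> W w j \<in> C"
    "\<And>x. x \<in> K \<Longrightarrow> \<exists>w<N. \<forall>j<n. (f ^^ j) x \<in> ideal_ball s (W w j)"
    using assms(1) by (rule word_coverE) blast
  define V where "V w = W (if w < N then w else 0)" for w
  have "V w j \<in> C'" if "j < n" for w j using W(1) assms that by (auto simp: V_def)
  moreover have "\<exists>w<N'. \<forall>j<n. (f ^^ j) x \<in> ideal_ball s (V w j)" if x: "x \<in> K" for x
  proof -
    obtain w where "w < N" "\<forall>j<n. (f ^^ j) x \<in> ideal_ball s (W w j)" using W(2)[OF x] by blast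
    then show ?thesis using assms(4) by (intro exI[of _ w]) (auto simp: V_def)
  qed
  ultimately show ?thesis unfolding word_cover_def by blast
qed

lemma word_cover_cover_number:
  assumes "finite C" "K \<subseteq> (\<Union>c\<in>C. ideal_ball s c)" "f ` K \<subseteq> K"
  shows "word_cover s K f C (cover_number K f (ideal_ball s ` C) n) n"
proof -
  let ?N = "cover_number K f (ideal_ball s ` C) n"
  obtain \<V> where V: "\<V> \<subseteq> iterated_join f (ideal_ball s ` C) n" "K \<subseteq> \<Union>\<V>" "finite \<V>" "card \<V> = ?N"
    using cover_number_attained[of "ideal_ball s ` C" K f n] assms by auto
  obtain A where A: "bij_betw A {..<?N} \<V>"
    using ex_bij_betw_nat_finite[OF V(3)] V(4) by (auto simp: lessThan_atLeast0)
  have "\<exists>v. (\<forall>j<n. v j \<in> C) \<and> A w = {x. \<forall>j<n. (f ^^ j) x \<in> ideal_ball s (v j)}" if "w < ?N" for w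
  proof -
    have "A w \<in> iterated_join f (ideal_ball s ` C) n"
      using bij_betwE[OF A] V(1) that by blast
    then obtain u where u: "\<forall>j<n. u j \<in> ideal_ball s ` C" "A w = {x. \<forall>j<n. (f ^^ j) x \<in> u j}"
      by (auto simp: mem_iterated_join)
    then have "\<forall>j<n. \<exists>c. c \<in> C \<and> u j = ideal_ball s c" by blast
    then obtain v where "\<forall>j<n. v j \<in> C \<and> u j = ideal_ball s (v j)" by metis
    then show ?thesis using u(2) by (intro exI[of _ v]) auto
  qed
  then have "\<forall>w\<in>{..<?N}. \<exists>v. (\<forall>j<n. v j \<in> C) \<and> A w = {x. \<forall>j<n. (f ^^ j) x \<in> ideal_ball s (v j)}"
    by simp
  from bchoice[OF this] obtain W where
    W: "\<forall>w\<in>{..<?N}. (\<forall>j<n. W w j \<in> C) \<and> A w = {x. \<forall>j<n. (f ^^ j) x \<in> ideal_ball s (W w j)}" ..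
  have "\<exists>w<?N. \<forall>j<n. (f ^^ j) x \<in> ideal_ball s (W w j)" if x: "x \<in> K" for x
  proof -
    obtain B where "B \<in> \<V>" "x \<in> B" using V(2) x by blast
    then obtain w where "w < ?N" "A w = B" using A by (auto simp: bij_betw_def)
    with \<open>x \<in> B\<close> W show ?thesis by (intro exI[of _ w]) auto
  qed
  with W show ?thesis unfolding word_cover_def by (intro exI[of _ W]) auto
qed

text \<open>
  The growth rate \<open>H\<^sub>k\<close> of the number of words of balls of radius below \<open>1 / (k + 1)\<close>, with word
  numbers restricted to powers of two so that no logarithm has to be computed.
\<close>

definition scale_entropy :: "(nat \<Rightarrow> 'a::metric_space) \<Rightarrow> 'a set \<Rightarrow> ('a \<Rightarrow> 'a) \<Rightarrow> nat \<Rightarrow> ereal" where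
  "scale_entropy s K f k =
     (INF (a, n)\<in>{(a, n). 1 \<le> n \<and> word_cover s K f (small_balls k) (2 ^ a) n}. ereal (real a / real n))"

lemma scale_entropy_le:
  "1 \<le> n \<Longrightarrow> word_cover s K f (small_balls k) (2 ^ a) n \<Longrightarrow> scale_entropy s K f k \<le> ereal (real a / real n)"
  unfolding scale_entropy_def by (intro INF_lower2[of "(a, n)"]) auto

lemma scale_entropy_greatest:
  "(\<And>a n. 1 \<le> n \<Longrightarrow> word_cover s K f (small_balls k) (2 ^ a) n \<Longrightarrow> x \<le> ereal (real a / real n)) \<Longrightarrow>
    x \<le> scale_entropy s K f k"
  unfolding scale_entropy_def by (intro INF_greatest) auto

lemma scale_entropy_mono:
  assumes "k \<le> k'"
  shows "scale_entropy s K f k \<le> scale_entropy s K f k'"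
proof (rule scale_entropy_greatest)
  fix a n :: nat
  assume n: "1 \<le> n" and c: "word_cover s K f (small_balls k') (2 ^ a) n"
  have "1 / real (k' + 1) \<le> 1 / real (k + 1)"
    using assms by (intro divide_left_mono) auto
  then have "small_balls k' \<subseteq> small_balls k" by (auto simp: small_balls_def)
  then show "scale_entropy s K f k \<le> ereal (real a / real n)"
    using n word_cover_mono[OF c] by (intro scale_entropy_le) auto
qed

text \<open>
  If \<open>N\<close> words of length \<open>n\<close> suffice, then so do \<open>N ^ l\<close> words of length \<open>l * n\<close>, hence \<open>2 ^ a\<close>
  words with \<open>a \<le> l * log 2 N + 1\<close>. The error from rounding up to a power of two is at most
  \<open>1 / l\<close>, and \<open>l\<close> is arbitrary.
\<close>

lemma scale_entropy_le_cover_entropy: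
  assumes "finite C" "C \<subseteq> small_balls k" "K \<subseteq> (\<Union>c\<in>C. ideal_ball s c)" "f ` K \<subseteq> K" "K \<noteq> {}"
  shows "scale_entropy s K f k \<le> cover_entropy K f (ideal_ball s ` C)"
  unfolding cover_entropy_def
proof (rule INF_greatest)
  fix n :: nat assume "n \<in> {1..}"
  then have n: "1 \<le> n" by simp
  let ?N = "cover_number K f (ideal_ball s ` C) n"
  have cov: "word_cover s K f C ?N n" by (rule word_cover_cover_number[OF assms(1,3,4)])
  then have "0 < ?N" using assms(5) by (auto simp: word_cover_def intro: gr0I)
  have bound: "scale_entropy s K f k \<le> ereal (log 2 ?N / n + 1 / l)" if "0 < l" for l :: nat
  proof -
    define a where "a = nat \<lceil>l * log 2 ?N\<rceil>"
    have "0 \<le> log 2 ?N" using \<open>0 < ?N\<close> by simp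
    then have a: "l * log 2 ?N \<le> a" "a \<le> l * log 2 ?N + 1"
      unfolding a_def by (simp_all add: of_nat_nat)
    have "real (?N ^ l) = 2 powr (l * log 2 ?N)"
      using \<open>0 < ?N\<close> by (simp add: mult.commute[of "real l"] powr_powr[symmetric] powr_realpow)
    also have "\<dots> \<le> 2 powr a" using a(1) by simp
    also have "\<dots> = real (2 ^ a)" by (simp add: powr_realpow)
    finally have "?N ^ l \<le> 2 ^ a" by (simp only: of_nat_le_iff)
    then have "word_cover s K f (small_balls k) (2 ^ a) (l * n)"
      using word_cover_mono[OF word_cover_power[OF assms(4) cov] assms(2)] \<open>0 < ?N\<close> by simp
    then have "scale_entropy s K f k \<le> ereal (real a / real (l * n))"
      using n that by (intro scale_entropy_le) auto
    also have "real a / real (l * n) \<le> (l * log 2 ?N + 1) / real (l * n)"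
      using a(2) by (intro divide_right_mono) auto
    also have "\<dots> = log 2 ?N / n + 1 / (l * n)"
      using n that by (simp add: field_simps)
    also have "\<dots> \<le> log 2 ?N / n + 1 / l"
      using n that by (intro add_left_mono divide_left_mono) auto
    finally show ?thesis by simp
  qed
  show "scale_entropy s K f k \<le> ereal (log 2 ?N / n)"
  proof (rule ereal_le_epsilon2)
    fix e :: real assume "0 < e"
    then obtain l where "0 < l" "1 / real l < e"
      by (metis nat_approx_posE zero_less_Suc)
    then have "ereal (log 2 ?N / n + 1 / l) \<le> ereal (log 2 ?N / n) + ereal e" by simp
    with bound[OF \<open>0 < l\<close>] show "scale_entropy s K f k \<le> ereal (log 2 ?N / n) + ereal e"
      by (rule order_trans)
  qed
qed

lemma topological_entropy_eq_SUP_scale_entropy: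
  assumes dense: "closure (range s) = UNIV" and "compact K" "K \<noteq> {}" "f ` K \<subseteq> K"
  shows "topological_entropy K f = (SUP k. scale_entropy s K f k)"
proof (rule antisym)
  show "topological_entropy K f \<le> (SUP k. scale_entropy s K f k)"
    unfolding topological_entropy_def
  proof (rule SUP_least)
    fix \<U> assume "\<U> \<in> {\<U>. finite \<U> \<and> open_cover K \<U>}"
    then have "K \<subseteq> \<Union>\<U>" "\<And>U. U \<in> \<U> \<Longrightarrow> open U" by (auto simp: open_cover_def)
    then obtain \<delta> where \<delta>: "0 < \<delta>" "\<And>x. x \<in> K \<Longrightarrow> \<exists>U\<in>\<U>. ball x \<delta> \<subseteq> U"
      using Heine_Borel_lemma[OF \<open>compact K\<close>] by metis
    obtain k where k: "1 / real (Suc k) < \<delta> / 2"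
      using nat_approx_posE[of "\<delta> / 2"] \<delta>(1) by auto
    have "cover_entropy K f \<U> \<le> scale_entropy s K f k"
      by (intro scale_entropy_greatest cover_entropy_le_word_cover[OF \<delta>(2), of _ k]) (use k assms(4) in auto)
    then show "cover_entropy K f \<U> \<le> (SUP k. scale_entropy s K f k)"
      by (rule order_trans) (rule SUP_upper, simp)
  qed
  show "(SUP k. scale_entropy s K f k) \<le> topological_entropy K f"
  proof (rule SUP_least)
    fix k
    have "K \<subseteq> (\<Union>c\<in>small_balls k. ideal_ball s c)"
    proof
      fix x
      have "0 < 1 / real (k + 1)" by simp
      from small_ideal_ball[OF dense this] show "x \<in> (\<Union>c\<in>small_balls k. ideal_ball s c)"
        by (auto simp: small_balls_def)
    qed
    then obtain C where C: "C \<subseteq> small_balls k" "finite C" "K \<subseteq> (\<Union>c\<in>C. ideal_ball s c)"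
      by (rule compactE_image[OF \<open>compact K\<close>, rotated]) (auto simp: ideal_ball_eq)
    have "scale_entropy s K f k \<le> cover_entropy K f (ideal_ball s ` C)"
      by (rule scale_entropy_le_cover_entropy[OF C(2,1,3) assms(4,3)])
    also have "\<dots> \<le> topological_entropy K f"
      unfolding topological_entropy_def using C
      by (intro SUP_upper) (auto simp: open_cover_def ideal_ball_eq)
    finally show "scale_entropy s K f k \<le> topological_entropy K f" .
  qed
qed

section \<open>Topological entropy is second-level computable\<close>

theorem theoremA:
  fixes s :: "nat \<Rightarrow> 'a::metric_space"
    and K :: "'a set"
    and f :: "'a \<Rightarrow> 'a"
  assumes "computable_metric_space s"
    and "recursively_compact s"
    and "computable_dynamical_system s K f"
  shows "Sigma2_computable (topological_entropy K f)"
proof -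
  have sys: "compact K" "K \<noteq> {}" "f ` K \<subseteq> K" "computable_map s f" "effective_closed s K"
    using assms(3) by (auto simp: computable_dynamical_system_def dynamical_system_def)
  have dense: "closure (range s) = UNIV" using assms(1) by (simp add: computable_metric_space_def)
  let ?H = "scale_entropy s K f"
  have h: "topological_entropy K f = (SUP k. ?H k)"
    by (rule topological_entropy_eq_SUP_scale_entropy[OF dense sys(1-3)])
  have "0 \<le> ?H 0" by (rule scale_entropy_greatest) simp
  also have "\<dots> \<le> topological_entropy K f" unfolding h by (rule SUP_upper) simp
  finally have nonneg: "0 \<le> topological_entropy K f" .

  have "semidecidable (\<lambda>x. word_cover s K f (small_balls (pfst x)) (2 ^ pfst (psnd x)) (psnd (psnd x)))"
    by (intro semidecidable_word_cover assms(1,2) sys(4,5) prim_rec_small_balls prim_rec_intros prim_rec.pfst)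
  then obtain P where
    P: "\<And>g t. prim_rec g \<Longrightarrow> prim_rec t \<Longrightarrow> prim_rec_pred (\<lambda>x. P (g x) (t x))"
    and cov: "\<And>x. word_cover s K f (small_balls (pfst x)) (2 ^ pfst (psnd x)) (psnd (psnd x)) \<longleftrightarrow> (\<exists>t. P x t)"
    by (rule semidecidableE) blast
  define good where "good k a n t \<longleftrightarrow> 1 \<le> n \<and> P (prod_encode (k, prod_encode (a, n))) t" for k a n t
  have good: "(\<exists>t. good k a n t) \<longleftrightarrow> 1 \<le> n \<and> word_cover s K f (small_balls k) (2 ^ a) n" for k a n
    using cov[of "prod_encode (k, prod_encode (a, n))"] by (simp add: good_def)
  \<comment> \<open>\<open>x\<close> codes \<open>(k, (a, (n, t)))\<close>; the value codes \<open>a / n\<close> if \<open>t\<close> is a witness, and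
    \<open>k / 1\<close> otherwise, as \<open>2 * a\<close> is the code of the integer \<open>a\<close>.\<close>
  define F where "F x =
    (if good (pfst x) (pfst (psnd x)) (pfst (psnd (psnd x))) (psnd (psnd (psnd x)))
     then prod_encode (2 * pfst (psnd x), 2 * pfst (psnd (psnd x)))
     else prod_encode (2 * pfst x, 2))" for x
  have "prim_rec F"
    unfolding F_def good_def by (intro P prim_rec_intros)
  then obtain M where M: "turing_machine M" "\<And>i j. outputs M [i, j] (F (prod_encode (i, j)))"
    using turing_computes_prim_rec by blast
  have frac: "real_of_rat (nat_to_rat_surj (prod_encode (2 * a, 2 * n))) = real a / real n" for a n
  proof (cases "n = 0")
    case True
    then show ?thesis by (simp add: nat_to_rat_surj_def int_decode_def sum_decode_def rat_number_collapse)
  next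
    case False
    then show ?thesis by (simp add: nat_to_rat_surj_def int_decode_def sum_decode_def of_rat_rat)
  qed
  define q where "q i j = nat_to_rat_surj (F (prod_encode (i, j)))" for i j
  have q: "real_of_rat (q k (prod_encode (a, prod_encode (n, t)))) = (if good k a n t then real a / real n else real k)"
    for k a n t using frac[of k 1] by (auto simp: q_def F_def frac)
  have "(INF j. ereal (real_of_rat (q k j))) \<le> ?H k" for k
  proof (rule scale_entropy_greatest)
    fix a n :: nat assume "1 \<le> n" "word_cover s K f (small_balls k) (2 ^ a) n"
    then obtain t where "good k a n t" using good by blast
    then show "(INF j. ereal (real_of_rat (q k j))) \<le> ereal (real a / real n)"
      by (intro INF_lower2[of "prod_encode (a, prod_encode (n, t))"]) (auto simp: q)
  qed
  then have le: "(SUP k. INF j. ereal (real_of_rat (q k j))) \<le> (SUP k. ?H k)"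
    by (intro SUP_mono) auto
  have ge: "(SUP k. ?H k) \<le> (SUP k. INF j. ereal (real_of_rat (q k j)))"
  proof (rule dense_le)
    fix y assume "y < (SUP k. ?H k)"
    then obtain k where k: "y < ?H k" by (auto simp: less_SUP_iff)
    then obtain m :: nat where m: "y < ereal (real m)"
      using less_PInf_Ex_of_nat[of y] by (metis ereal_infty_less(1) ereal_less_PInfty less_ereal.simps(2) less_le_trans top_greatest top_ereal_def less_le)
    \<comment> \<open>\<open>k'\<close> is so large that neither the growth rate at this scale nor the default value
      falls below \<open>y\<close>.\<close>
    define k' where "k' = max k m"
    have y: "y < ?H k'" using k scale_entropy_mono[of k k' s K f] by (auto simp: k'_def intro: less_le_trans)
    have y': "y \<le> ereal (real k')"
      using m by (metis k'_def ereal_less_eq(3) less_imp_le max.cobounded2 of_nat_le_iff order_trans)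
    have "y \<le> ereal (real_of_rat (q k' j))" for j
    proof -
      define a n t where "a = pfst j" and "n = pfst (psnd j)" and "t = psnd (psnd j)"
      have j: "j = prod_encode (a, prod_encode (n, t))" by (simp add: a_def n_def t_def)
      show ?thesis
      proof (cases "good k' a n t")
        case True
        then have "?H k' \<le> ereal (real a / real n)" using good by (intro scale_entropy_le) auto
        then show ?thesis using y True by (simp add: j q)
      next
        case False
        then show ?thesis using y' by (simp add: j q)
      qed
    qed
    then have "y \<le> (INF j. ereal (real_of_rat (q k' j)))" by (intro INF_greatest)
    also have "\<dots> \<le> (SUP k. INF j. ereal (real_of_rat (q k j)))" by (rule SUP_upper) simp
    finally show "y \<le> (SUP k. INF j. ereal (real_of_rat (q k j)))" .
  qed
  have "topological_entropy K f = (SUP k. INF j. ereal (real_of_rat (q k j)))"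
    unfolding h using le ge by (rule antisym[rotated])
  moreover have "\<forall>i j. \<exists>c. outputs M [i, j] c \<and> nat_to_rat_surj c = q i j"
    using M(2) by (auto simp: q_def)
  moreover have "topological_entropy K f \<noteq> - \<infinity>" using nonneg by auto
  ultimately show ?thesis unfolding Sigma2_computable_def using M(1) by blast
qed

end
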